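(* Let $k\geq 2$ be an integer and let $G$ be a non-bipartite graph of order $n\geq 2k+3$ which contains none of the cycles $C_3, C_5, \ldots, C_{2k+1}$ as a subgraph. Then $$q(G)\leq q\big(C_{2k+3}\circ(n-2k-2,1,\ldots,1)\big),$$ with equality if and only if $G\cong C_{2k+3}\circ(n-2k-2,1,\ldots,1)$.
   Context: All graphs are simple. For a graph $G$, $Q(G)=D(G)+A(G)$ is the signless Laplacian matrix, where $D(G)$ is the diagonal degree matrix and $A(G)$ the adjacency matrix; the $Q$-index $q(G)$ is the largest eigenvalue of $Q(G)$. A graph contains $H$ if it has a subgraph isomorphic to $H$; $C_\ell$ denotes the cycle on $\ell$ vertices. For a graph $H$ with vertices $v_1,\ldots,v_t$ and positive integers $r=(n_1,\ldots,n_t)$, the blow-up $H\circ r$ is obtained by replacing each $v_i$ by an independent set $V_i$ of $n_i$ vertices and joining every vertex of $V_i$ to every vertex of $V_j$ whenever $v_iv_j\in E(H)$. Here $C_{2k+3}$ has vertices $v_1,v_2,\ldots,v_{2k+3}$ in cyclic order, and $C_{2k+3}\circ(n-2k-2,1,\ldots,1)$ is the blow-up with $n_1=n-2k-2$ and $n_i=1$ for $2\le i\le 2k+3$ (a graph of order $n$). *)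

theory Defs
  imports
    "Graph_Theory.Graph_Theory"
    "Jordan_Normal_Form.Spectral_Radius"
begin

text \<open>
  A finite simple graph is a \<^const>\<open>pair_graph\<close>: a finite vertex set together with a symmetric
  irreflexive set of arcs, where the edge $uv$ is represented by the two arcs $(u,v)$ and $(v,u)$.
  In particular \<^const>\<open>out_degree\<close> is the degree.
\<close>

definition bipartite :: "'a pair_pre_digraph \<Rightarrow> bool" where
  "bipartite G \<longleftrightarrow> (\<exists>U W. pverts G = U \<union> W \<and> U \<inter> W = {} \<and> parcs G \<subseteq> U \<times> W \<union> W \<times> U)"

definition contains_graph :: "'a pair_pre_digraph \<Rightarrow> 'b pair_pre_digraph \<Rightarrow> bool" where
  "contains_graph G H \<longleftrightarrow>
     (\<exists>S. subgraph (with_proj S) (with_proj G) \<and> digraph_iso (with_proj S) (with_proj H))"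

text \<open>The vertex $v_i$ of $C_\ell$ is the number $i$; this is the cycle only for $\ell \ge 3$.\<close>

definition cycle_graph :: "nat \<Rightarrow> nat pair_pre_digraph" where
  "cycle_graph l = \<lparr> pverts = {1..l},
     parcs = {(i, j). i \<in> {1..l} \<and> j \<in> {1..l} \<and> (j = i mod l + 1 \<or> i = j mod l + 1)} \<rparr>"

definition blow_up :: "'a pair_pre_digraph \<Rightarrow> ('a \<Rightarrow> nat) \<Rightarrow> ('a \<times> nat) pair_pre_digraph" where
  "blow_up H r = \<lparr> pverts = (SIGMA v:pverts H. {..<r v}),
     parcs = {((u, i), (v, j)). (u, v) \<in> parcs H \<and> i < r u \<and> j < r v} \<rparr>"

text \<open>
  Matrices are indexed by \<open>0, \<dots>, n - 1\<close>, so the matrices of a graph are taken with respect to an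
  enumeration \<open>vs\<close> of its vertices. The spectrum does not depend on it, see
  \<open>spectrum_signless_laplacian_cong\<close> below.
\<close>

definition adjacency_matrix :: "'a list \<Rightarrow> 'a pair_pre_digraph \<Rightarrow> real mat" where
  "adjacency_matrix vs G = mat (length vs) (length vs)
     (\<lambda>(i, j). if (vs ! i, vs ! j) \<in> parcs G then 1 else 0)"

definition degree_matrix :: "'a list \<Rightarrow> 'a pair_pre_digraph \<Rightarrow> real mat" where
  "degree_matrix vs G = mat (length vs) (length vs)
     (\<lambda>(i, j). if i = j then real (out_degree (with_proj G) (vs ! i)) else 0)"

definition signless_laplacian :: "'a list \<Rightarrow> 'a pair_pre_digraph \<Rightarrow> real mat" where
  "signless_laplacian vs G = degree_matrix vs G + adjacency_matrix vs G"

definition vertex_list :: "'a pair_pre_digraph \<Rightarrow> 'a list" where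
  "vertex_list G = (SOME vs. distinct vs \<and> set vs = pverts G)"

definition q_index :: "'a pair_pre_digraph \<Rightarrow> real" where
  "q_index G = Max (spectrum (signless_laplacian (vertex_list G) G))"

lemma vertex_list:
  assumes "finite (pverts G)"
  shows "distinct (vertex_list G)" "set (vertex_list G) = pverts G"
proof -
  have "\<exists>vs. distinct vs \<and> set vs = pverts G"
    using finite_distinct_list[OF assms] by blast
  then have "distinct (vertex_list G) \<and> set (vertex_list G) = pverts G"
    unfolding vertex_list_def by (rule someI_ex)
  then show "distinct (vertex_list G)" "set (vertex_list G) = pverts G" by auto
qed

lemma eigenvalue_signless_laplacian_iff:
  assumes vs: "distinct vs" "set vs = pverts G"
  shows "eigenvalue (signless_laplacian vs G) c \<longleftrightarrow>
    (\<exists>x. (\<exists>v\<in>pverts G. x v \<noteq> 0) \<and>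
      (\<forall>u\<in>pverts G. real (out_degree (with_proj G) u) * x u
         + (\<Sum>v\<in>pverts G. if (u, v) \<in> parcs G then x v else 0) = c * x u))"
    (is "?L \<longleftrightarrow> ?R")
proof -
  let ?n = "length vs"
  have row: "(signless_laplacian vs G *\<^sub>v vec ?n (\<lambda>i. x (vs ! i))) $ i =
      real (out_degree (with_proj G) (vs ! i)) * x (vs ! i)
       + (\<Sum>v\<in>pverts G. if (vs ! i, v) \<in> parcs G then x v else 0)"
    if i: "i < ?n" for x i
  proof -
    have "(signless_laplacian vs G *\<^sub>v vec ?n (\<lambda>i. x (vs ! i))) $ i =
      (\<Sum>j<?n. (if i = j then real (out_degree (with_proj G) (vs ! i)) * x (vs ! j) else 0)
         + (if (vs ! i, vs ! j) \<in> parcs G then x (vs ! j) else 0))"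
      using i unfolding signless_laplacian_def degree_matrix_def adjacency_matrix_def
      by (simp add: scalar_prod_def lessThan_atLeast0 distrib_right sum.distrib
          if_distrib[of "\<lambda>t. t * _"] cong: if_cong)
    also have "\<dots> = real (out_degree (with_proj G) (vs ! i)) * x (vs ! i)
         + (\<Sum>j<?n. if (vs ! i, vs ! j) \<in> parcs G then x (vs ! j) else 0)"
      using i by (simp add: sum.distrib)
    also have "(\<Sum>j<?n. if (vs ! i, vs ! j) \<in> parcs G then x (vs ! j) else 0)
        = (\<Sum>v\<in>pverts G. if (vs ! i, v) \<in> parcs G then x v else 0)"
      by (rule sum.reindex_bij_betw[OF bij_betw_nth]) (use vs in auto)
    finally show ?thesis .
  qed
  have dim: "dim_row (signless_laplacian vs G) = ?n"
    by (simp add: signless_laplacian_def degree_matrix_def adjacency_matrix_def)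
  have ev: "eigenvector (signless_laplacian vs G) (vec ?n (\<lambda>i. x (vs ! i))) c \<longleftrightarrow>
     (\<exists>v\<in>pverts G. x v \<noteq> 0) \<and>
      (\<forall>u\<in>pverts G. real (out_degree (with_proj G) u) * x u
         + (\<Sum>v\<in>pverts G. if (u, v) \<in> parcs G then x v else 0) = c * x u)" for x
  proof -
    have "vec ?n (\<lambda>i. x (vs ! i)) \<noteq> 0\<^sub>v ?n \<longleftrightarrow> (\<exists>i<?n. x (vs ! i) \<noteq> 0)"
      by (auto simp: vec_eq_iff)
    moreover have "signless_laplacian vs G *\<^sub>v vec ?n (\<lambda>i. x (vs ! i)) = c \<cdot>\<^sub>v vec ?n (\<lambda>i. x (vs ! i))
      \<longleftrightarrow> (\<forall>i<?n. (signless_laplacian vs G *\<^sub>v vec ?n (\<lambda>i. x (vs ! i))) $ i = c * x (vs ! i))"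
      by (auto simp: vec_eq_iff dim simp del: index_mult_mat_vec)
    ultimately show ?thesis
      unfolding eigenvector_def dim vs(2)[symmetric] Ball_def Bex_def in_set_conv_nth
      using row vs(2) by auto
  qed
  show ?thesis
  proof
    assume ?L
    then obtain w where w: "eigenvector (signless_laplacian vs G) w c"
      unfolding eigenvalue_def by blast
    define x where "x v = w $ (THE i. i < ?n \<and> vs ! i = v)" for v
    have "x (vs ! i) = w $ i" if "i < ?n" for i
    proof -
      have "(THE j. j < ?n \<and> vs ! j = vs ! i) = i"
        using that vs(1) by (auto simp: nth_eq_iff_index_eq)
      then show ?thesis by (simp add: x_def)
    qed
    moreover have "dim_vec w = ?n" using w by (simp add: eigenvector_def dim)
    ultimately have "w = vec ?n (\<lambda>i. x (vs ! i))" by (auto simp: vec_eq_iff)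
    with w ev show ?R by blast
  next
    assume ?R
    then show ?L unfolding eigenvalue_def using ev by blast
  qed
qed

lemma spectrum_signless_laplacian_cong:
  assumes "distinct vs" "set vs = pverts G" "distinct ws" "set ws = pverts G"
  shows "spectrum (signless_laplacian vs G) = spectrum (signless_laplacian ws G)"
  using eigenvalue_signless_laplacian_iff[OF assms(1,2)] eigenvalue_signless_laplacian_iff[OF assms(3,4)]
  by (auto simp: spectrum_def)

lemma pair_graph_cycle_graph:
  assumes "l \<ge> 3"
  shows "pair_graph (cycle_graph l)"
proof -
  have "i mod l + 1 \<noteq> i" if "i \<in> {1..l}" for i
    using that assms by (cases "i = l") auto
  then have "(i, i) \<notin> parcs (cycle_graph l)" for i
    by (fastforce simp: cycle_graph_def)
  moreover have "finite (parcs (cycle_graph l))"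
    by (rule finite_subset[of _ "{1..l} \<times> {1..l}"]) (auto simp: cycle_graph_def)
  moreover have "finite (pverts (cycle_graph l))" "sym (parcs (cycle_graph l))"
    "parcs (cycle_graph l) \<subseteq> pverts (cycle_graph l) \<times> pverts (cycle_graph l)"
    by (auto simp: cycle_graph_def sym_def)
  ultimately show ?thesis
    by unfold_locales (auto simp: symmetric_def)
qed

lemma pair_graph_blow_up:
  assumes "pair_graph H"
  shows "pair_graph (blow_up H r)"
proof -
  interpret H: pair_graph H by fact
  have fin: "finite (SIGMA v:pverts H. {..<r v})" by auto
  have "finite (parcs (blow_up H r))"
    by (rule finite_subset[OF _ finite_cartesian_product[OF fin fin]])
       (auto simp: blow_up_def dest: H.wellformed')
  moreover have "sym (parcs H)"
    using H.pair_sym_arcs by (simp add: symmetric_def)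
  ultimately show ?thesis
    using fin by unfold_locales
      (auto simp: blow_up_def symmetric_def sym_def dest: H.wellformed' H.pair_no_loops)
qed

end

theory Submission
  imports Defs
begin

text \<open>
  Put $L = 2k+3$ and $N = n-2k+1$. If $w > 0$ satisfies $Qw \le cw$, then every eigenvalue of $Q$
  is at most $c$. A vertex has at most two neighbours on a shortest odd cycle, so $d(u) + d(v) \le N$
  for every edge $uv$. If no edge attains $N$, then $w = d$ gives $q(G) \le N - 1$. If $uv$ attains
  $N$, then the shortest odd cycle has length $L$, may be assumed to contain $uv$, and every other
  vertex is adjacent to $u$ or $v$. Hence $G$ is a spanning subgraph of a blow-up of $C_L$ in which
  only four consecutive classes may have more than one vertex, with sizes $a, b, c, d$ of sum $N$.
  Unless three of these sizes are $1$, an explicit $w$ shows $q(G) \le N - 1/N$, whereas an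
  eigenvector of the extremal graph written in powers of $t$, $t + 1/t = q - 2$, shows that its
  $Q$-index exceeds $N - 1/N$. In the remaining case $G$ is a spanning subgraph of the extremal
  graph, and equality forces all edges to be present.
\<close>

text \<open>The count behind \<open>N\<close>: a shortest odd cycle contributes at most 4 to a
  degree sum, and each of the at most \<open>n - L\<close> other vertices at most 1, since there are
  no triangles. This bound alone cannot decide: in the extremal graph the edges between the blown-up
  class and its neighbours have degree sum \<open>N\<close> as well, and so has the middle edge of
  every competing blow-up. Hence the threshold \<open>N - 1/N\<close>. The correction
  \<open>1/N\<close> comes from integrality: where degree sums fall short at a vertex, they lose at
  least 1 in total, against a weight of at most \<open>N\<close>. Vertices all of whose edges are
  tight lose nothing, and for them the weights must depart from the degrees. The extremal graph only
  just clears the threshold: with \<open>\<delta> = N - q\<close> its eigenvalue equation implies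
  \<open>t^2 <= 1 - N * \<delta> + \<delta>^2\<close>, so \<open>\<delta> >= 1/N\<close> would force
  \<open>t <= 1/N\<close>, whereas \<open>q <= N\<close> already gives
  \<open>t > 1/N\<close>.\<close>

section \<open>Eigenvalues of the signless Laplacian\<close>

text \<open>A complex eigenvalue \<open>c\<close> exists. The form \<open>S\<close>, that is
  \<open>v^* A v\<close>, equals \<open>c\<close> times the squared norm of \<open>v\<close> and, as
  \<open>A\<close> is real and symmetric, its own conjugate. So \<open>c\<close> is real and a root
  of the real characteristic polynomial.\<close>

lemma symmetric_real_mat_spectrum_nonempty:
  fixes A :: "real mat"
  assumes A: "A \<in> carrier_mat n n" and "n > 0"
    and sym: "\<And>i j. i < n \<Longrightarrow> j < n \<Longrightarrow> A $$ (i, j) = A $$ (j, i)"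
  shows "spectrum A \<noteq> {}"
proof -
  let ?B = "map_mat complex_of_real A"
  have B: "?B \<in> carrier_mat n n" using A by simp
  obtain c where c: "c \<in> spectrum ?B"
    using spectrum_non_empty[OF B \<open>n > 0\<close>] by blast
  then obtain v where "eigenvector ?B v c"
    unfolding spectrum_def eigenvalue_def by blast
  then have v: "v \<in> carrier_vec n" "v \<noteq> 0\<^sub>v n" "?B *\<^sub>v v = c \<cdot>\<^sub>v v"
    using A by (auto simp: eigenvector_def)
  define r where "r = (\<Sum>i<n. (cmod (v $ i))\<^sup>2)"
  define S where "S = (\<Sum>i<n. \<Sum>j<n. cnj (v $ i) * (complex_of_real (A $$ (i, j)) * v $ j))"
  have row: "(\<Sum>j<n. complex_of_real (A $$ (i, j)) * v $ j) = c * v $ i" if "i < n" for i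
  proof -
    have "(?B *\<^sub>v v) $ i = (\<Sum>j<n. complex_of_real (A $$ (i, j)) * v $ j)"
      using A v(1) that by (simp add: scalar_prod_def lessThan_atLeast0)
    then show ?thesis using v that by simp
  qed
  have "S = (\<Sum>i<n. cnj (v $ i) * (c * v $ i))"
    unfolding S_def by (simp add: sum_distrib_left[symmetric] row)
  also have "\<dots> = c * complex_of_real r"
    unfolding r_def of_real_sum sum_distrib_left
    by (intro sum.cong refl) (simp add: complex_norm_square ac_simps del: of_real_power)
  finally have S: "S = c * complex_of_real r" .
  have "cnj S = (\<Sum>i<n. \<Sum>j<n. v $ i * (complex_of_real (A $$ (i, j)) * cnj (v $ j)))"
    by (simp add: S_def)
  also have "\<dots> = (\<Sum>j<n. \<Sum>i<n. v $ i * (complex_of_real (A $$ (i, j)) * cnj (v $ j)))"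
    by (rule sum.swap)
  also have "\<dots> = S"
    unfolding S_def by (intro sum.cong refl) (auto simp: sym ac_simps)
  finally have "cnj c * complex_of_real r = c * complex_of_real r" by (simp add: S)
  moreover have "r \<noteq> 0"
  proof -
    obtain i where "i < n" "v $ i \<noteq> 0" using v(1,2) by (auto simp: vec_eq_iff)
    then have "r > 0" unfolding r_def by (intro sum_pos2[of _ i]) auto
    then show ?thesis by simp
  qed
  ultimately have "cnj c = c" by simp
  then have "c = complex_of_real (Re c)" by (simp add: complex_eq_iff)
  moreover have "poly (char_poly ?B) c = 0"
    using c eigenvalue_root_char_poly[OF B] by (simp add: spectrum_def)
  ultimately have "poly (map_poly complex_of_real (char_poly A)) (complex_of_real (Re c)) = 0"
    by (simp add: of_real_hom.char_poly_hom[OF A])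
  then have "poly (char_poly A) (Re c) = 0" by simp
  then show ?thesis using eigenvalue_root_char_poly[OF A] by (auto simp: spectrum_def)
qed

definition nbrs :: "'a pair_pre_digraph \<Rightarrow> 'a \<Rightarrow> 'a set" where
  "nbrs G u = {v. (u, v) \<in> parcs G}"

text \<open>Entry \<open>u\<close> of \<open>Q x\<close> is the sum of \<open>x u + x v\<close> over
  the edges at \<open>u\<close>. This form needs no enumeration of the vertices and can be estimated
  edge by edge.\<close>

definition q_spectrum :: "'a pair_pre_digraph \<Rightarrow> real set" where
  "q_spectrum G = {c. \<exists>x. (\<exists>v\<in>pverts G. x v \<noteq> 0) \<and>
      (\<forall>u\<in>pverts G. (\<Sum>v\<in>nbrs G u. x u + x v) = c * x u)}"

context pair_graph
begin

lemma nbrs_subset: "nbrs G u \<subseteq> pverts G"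
  by (auto simp: nbrs_def dest: wellformed')

lemma finite_nbrs [simp]: "finite (nbrs G u)"
  using nbrs_subset pair_finite_verts by (rule finite_subset)

lemma nbrs_sym: "v \<in> nbrs G u \<longleftrightarrow> u \<in> nbrs G v"
  by (auto simp: nbrs_def intro: arcs_symmetric)

lemma nbrs_irrefl: "u \<notin> nbrs G u"
  by (auto simp: nbrs_def dest: pair_no_loops)

lemma out_degree_eq_card_nbrs: "out_degree (with_proj G) u = card (nbrs G u)"
proof -
  have "out_arcs (with_proj G) u = Pair u ` nbrs G u"
    by (auto simp: out_arcs_def nbrs_def)
  then show ?thesis
    unfolding out_degree_def by (simp add: card_image inj_on_def)
qed

lemma spectrum_eq_q_spectrum: "spectrum (signless_laplacian (vertex_list G) G) = q_spectrum G"
proof -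
  have "real (out_degree (with_proj G) u) * x u + (\<Sum>v\<in>pverts G. if (u, v) \<in> parcs G then x v else 0)
     = (\<Sum>v\<in>nbrs G u. x u + x v)" for u x
  proof -
    have "(\<Sum>v\<in>pverts G. if (u, v) \<in> parcs G then x v else 0) = (\<Sum>v\<in>nbrs G u. x v)"
      using nbrs_subset[of u] pair_finite_verts
      by (intro sum.mono_neutral_cong_right) (auto simp: nbrs_def)
    then show ?thesis by (simp add: out_degree_eq_card_nbrs sum.distrib)
  qed
  then show ?thesis
    unfolding spectrum_def q_spectrum_def
    using eigenvalue_signless_laplacian_iff[OF vertex_list[OF pair_finite_verts]]
    by (intro Collect_cong) (simp only:)
qed

lemma finite_q_spectrum: "finite (q_spectrum G)"
  unfolding spectrum_eq_q_spectrum[symmetric]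
  by (rule card_finite_spectrum[where n = "length (vertex_list G)"])
     (simp add: signless_laplacian_def degree_matrix_def adjacency_matrix_def)

lemma q_spectrum_nonempty:
  assumes "pverts G \<noteq> {}"
  shows "q_spectrum G \<noteq> {}"
  unfolding spectrum_eq_q_spectrum[symmetric]
proof (rule symmetric_real_mat_spectrum_nonempty)
  show "signless_laplacian (vertex_list G) G \<in>
      carrier_mat (length (vertex_list G)) (length (vertex_list G))"
    by (simp add: signless_laplacian_def degree_matrix_def adjacency_matrix_def)
  show "length (vertex_list G) > 0"
    using assms vertex_list(2)[OF pair_finite_verts] by auto
  show "signless_laplacian (vertex_list G) G $$ (i, j) = signless_laplacian (vertex_list G) G $$ (j, i)"
    if "i < length (vertex_list G)" "j < length (vertex_list G)" for i j
    using that arcs_symmetric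
    by (auto simp: signless_laplacian_def degree_matrix_def adjacency_matrix_def)
qed

lemma q_index_mem:
  assumes "pverts G \<noteq> {}"
  shows "q_index G \<in> q_spectrum G"
  unfolding q_index_def spectrum_eq_q_spectrum
  using finite_q_spectrum q_spectrum_nonempty[OF assms] by (rule Max_in)

lemma q_index_eqI:
  assumes "q \<in> q_spectrum G" "\<And>c. c \<in> q_spectrum G \<Longrightarrow> c \<le> q"
  shows "q_index G = q"
  unfolding q_index_def spectrum_eq_q_spectrum
  using finite_q_spectrum assms by (intro Max_eqI) auto

text \<open>Compare an eigenvector \<open>x\<close> with \<open>w\<close> at the vertices where \<open>\<bar>x\<bar> / w\<close> is maximal.\<close>

lemma q_spectrum_le_supersolution:
  assumes c: "c \<in> q_spectrum G"
    and pos: "\<And>u. u \<in> pverts G \<Longrightarrow> w u > 0"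
    and super: "\<And>u. u \<in> pverts G \<Longrightarrow> (\<Sum>v\<in>nbrs G u. w u + w v) \<le> q * w u"
  shows "c \<le> q"
    and "c = q \<Longrightarrow> \<exists>M\<subseteq>pverts G. M \<noteq> {} \<and>
      (\<forall>u\<in>M. nbrs G u \<subseteq> M \<and> (\<Sum>v\<in>nbrs G u. w u + w v) = q * w u)"
proof -
  obtain x v0 where v0: "v0 \<in> pverts G" "x v0 \<noteq> 0"
    and x: "\<And>u. u \<in> pverts G \<Longrightarrow> (\<Sum>v\<in>nbrs G u. x u + x v) = c * x u"
    using c by (auto simp: q_spectrum_def)
  define R where "R = (\<lambda>u. \<bar>x u\<bar> / w u) ` pverts G"
  define r where "r = Max R"
  define M where "M = {u \<in> pverts G. \<bar>x u\<bar> = r * w u}"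
  have R: "finite R" "R \<noteq> {}" using pair_finite_verts v0 by (auto simp: R_def)
  have le: "\<bar>x u\<bar> \<le> r * w u" if "u \<in> pverts G" for u
  proof -
    have "\<bar>x u\<bar> / w u \<le> r" unfolding r_def using R that by (intro Max_ge) (auto simp: R_def)
    then show ?thesis using pos[OF that] by (simp add: divide_le_eq)
  qed
  have "r > 0"
  proof (rule ccontr)
    assume "\<not> r > 0"
    then have "r * w v0 \<le> 0" using pos[OF v0(1)] by (simp add: mult_nonpos_nonneg)
    then show False using le[OF v0(1)] v0(2) by auto
  qed
  have "r \<in> R" unfolding r_def using R by (rule Max_in)
  then obtain u0 where u0: "u0 \<in> pverts G" "r = \<bar>x u0\<bar> / w u0" by (auto simp: R_def)
  then have "u0 \<in> M" using pos[OF u0(1)] by (auto simp: M_def)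
  \<comment> \<open>The links are kept apart for the case \<open>c = q\<close>: then both ends agree
    and every link is an equality. The second one puts the neighbours of \<open>u\<close> into
    \<open>M\<close>, the third makes \<open>super\<close> tight at \<open>u\<close>.\<close>
  have chain: "c * (r * w u) \<le> (\<Sum>v\<in>nbrs G u. \<bar>x u\<bar> + \<bar>x v\<bar>)"
    "(\<Sum>v\<in>nbrs G u. \<bar>x u\<bar> + \<bar>x v\<bar>) \<le> (\<Sum>v\<in>nbrs G u. r * w u + r * w v)"
    "(\<Sum>v\<in>nbrs G u. r * w u + r * w v) \<le> r * (q * w u)"
    if "u \<in> M" for u
  proof -
    have u: "u \<in> pverts G" "\<bar>x u\<bar> = r * w u" using that by (auto simp: M_def)
    have "c * (r * w u) \<le> \<bar>c * x u\<bar>" using u(2)[symmetric]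
      by (simp add: abs_mult mult_right_mono)
    also have "\<dots> = \<bar>\<Sum>v\<in>nbrs G u. x u + x v\<bar>" using x[OF u(1)] by simp
    also have "\<dots> \<le> (\<Sum>v\<in>nbrs G u. \<bar>x u\<bar> + \<bar>x v\<bar>)"
      by (rule order_trans[OF sum_abs]) (intro sum_mono abs_triangle_ineq)
    finally show "c * (r * w u) \<le> (\<Sum>v\<in>nbrs G u. \<bar>x u\<bar> + \<bar>x v\<bar>)" .
    show "(\<Sum>v\<in>nbrs G u. \<bar>x u\<bar> + \<bar>x v\<bar>) \<le> (\<Sum>v\<in>nbrs G u. r * w u + r * w v)"
      using nbrs_subset u le by (intro sum_mono add_mono) auto
    have "(\<Sum>v\<in>nbrs G u. r * w u + r * w v) = r * (\<Sum>v\<in>nbrs G u. w u + w v)"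
      by (simp add: sum_distrib_left distrib_left)
    also have "\<dots> \<le> r * (q * w u)" using super[OF u(1)] \<open>r > 0\<close> by simp
    finally show "(\<Sum>v\<in>nbrs G u. r * w u + r * w v) \<le> r * (q * w u)" .
  qed
  have "c * (r * w u0) \<le> q * (r * w u0)"
    using chain[OF \<open>u0 \<in> M\<close>] by (simp add: ac_simps)
  then show "c \<le> q" using \<open>r > 0\<close> pos[OF u0(1)] by simp
  \<comment> \<open>\<open>M\<close> turns out to be a union of components, which is all that
    equality can give in a possibly disconnected graph.\<close>
  assume "c = q"
  have "nbrs G u \<subseteq> M \<and> (\<Sum>v\<in>nbrs G u. w u + w v) = q * w u" if "u \<in> M" for u
  proof -
    have ge: "r * (q * w u) \<le> (\<Sum>v\<in>nbrs G u. \<bar>x u\<bar> + \<bar>x v\<bar>)"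
      using chain(1)[OF that] \<open>c = q\<close> mult.left_commute[of r q "w u"] by (simp only:)
    have eq: "(\<Sum>v\<in>nbrs G u. r * w u + r * w v) = r * (q * w u)"
      "(\<Sum>v\<in>nbrs G u. \<bar>x u\<bar> + \<bar>x v\<bar>) = (\<Sum>v\<in>nbrs G u. r * w u + r * w v)"
      using order_trans[OF ge chain(2)[OF that]] order_trans[OF chain(3)[OF that] ge] chain(2,3)[OF that]
      by (blast intro: order_antisym)+
    have "(\<Sum>v\<in>nbrs G u. (r * w u + r * w v) - (\<bar>x u\<bar> + \<bar>x v\<bar>)) = 0"
      unfolding sum_subtractf eq(2) by simp
    moreover have "(r * w u + r * w v) - (\<bar>x u\<bar> + \<bar>x v\<bar>) \<ge> 0" if "v \<in> nbrs G u" for v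
    proof -
      have "u \<in> pverts G" "v \<in> pverts G" using \<open>u \<in> M\<close> that nbrs_subset by (auto simp: M_def)
      then show ?thesis using le[of u] le[of v] by linarith
    qed
    ultimately have zero: "(r * w u + r * w v) - (\<bar>x u\<bar> + \<bar>x v\<bar>) = 0" if "v \<in> nbrs G u" for v
      using that sum_nonneg_eq_0_iff[of "nbrs G u" "\<lambda>v. (r * w u + r * w v) - (\<bar>x u\<bar> + \<bar>x v\<bar>)"]
      by auto
    have "nbrs G u \<subseteq> M"
    proof
      fix v assume v: "v \<in> nbrs G u"
      then have "v \<in> pverts G" using nbrs_subset by auto
      moreover have "\<bar>x u\<bar> = r * w u" using \<open>u \<in> M\<close> by (simp add: M_def)
      ultimately show "v \<in> M" using zero[OF v] by (simp add: M_def)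
    qed
    moreover have "r * (\<Sum>v\<in>nbrs G u. w u + w v) = r * (q * w u)"
      using eq(1) by (simp add: sum_distrib_left distrib_left sum.distrib mult.left_commute)
    ultimately show ?thesis using \<open>r > 0\<close> by simp
  qed
  then show "\<exists>M\<subseteq>pverts G. M \<noteq> {} \<and>
      (\<forall>u\<in>M. nbrs G u \<subseteq> M \<and> (\<Sum>v\<in>nbrs G u. w u + w v) = q * w u)"
    using \<open>u0 \<in> M\<close> by (intro exI[of _ M]) (auto simp: M_def)
qed

text \<open>With the degrees as weights, the sum at \<open>u\<close> has as many terms as the degree
  of \<open>u\<close>, each of them an edge degree sum. Isolated vertices, whose sum is empty, get
  weight 1 to stay positive.\<close>

lemma q_spectrum_le_degree_sum:
  assumes c: "c \<in> q_spectrum G" and "d \<ge> 0"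
    and deg: "\<And>u v. v \<in> nbrs G u \<Longrightarrow> real (card (nbrs G u)) + real (card (nbrs G v)) \<le> d"
  shows "c \<le> d"
proof -
  define w where "w u = (if nbrs G u = {} then 1 else real (card (nbrs G u)))" for u
  have "w u > 0" for u by (simp add: w_def card_gt_0_iff)
  moreover have "(\<Sum>v\<in>nbrs G u. w u + w v) \<le> d * w u" for u
  proof (cases "nbrs G u = {}")
    case True
    then show ?thesis using \<open>d \<ge> 0\<close> by (simp add: w_def)
  next
    case False
    have "w u + w v \<le> d" if "v \<in> nbrs G u" for v
      using deg[OF that] that nbrs_sym[of v u] by (auto simp: w_def)
    then have "(\<Sum>v\<in>nbrs G u. w u + w v) \<le> real (card (nbrs G u)) * d"
      by (rule sum_bounded_above)
    then show ?thesis using False by (simp add: w_def mult.commute)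
  qed
  ultimately show ?thesis using q_spectrum_le_supersolution(1)[OF c] by blast
qed

end

section \<open>Transport along graph isomorphisms\<close>

lemma digraph_iso_with_projI:
  assumes G: "pair_wf_digraph G" and bij: "bij_betw h (pverts G) (pverts H)"
    and arcs: "\<And>u v. u \<in> pverts G \<Longrightarrow> v \<in> pverts G \<Longrightarrow> (h u, h v) \<in> parcs H \<longleftrightarrow> (u, v) \<in> parcs G"
    and H: "parcs H \<subseteq> pverts H \<times> pverts H"
  shows "digraph_iso (with_proj G) (with_proj H)"
proof -
  interpret pair_wf_digraph G by fact
  define f where "f = \<lparr>iso_verts = h, iso_arcs = map_prod h h, iso_head = snd, iso_tail = fst\<rparr>"
  have inj: "inj_on h (pverts G)" and img: "h ` pverts G = pverts H"
    using bij by (auto simp: bij_betw_def)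
  have "inj_on (map_prod h h) (parcs G)"
    by (rule inj_on_subset[of _ "pverts G \<times> pverts G"])
       (use inj wellformed' in \<open>auto intro: map_prod_inj_on\<close>)
  then have "pre_digraph.digraph_isomorphism (with_proj G) f"
    using inj wf_digraph_axioms
    by (auto simp: pre_digraph.digraph_isomorphism_def f_def)
  moreover have "parcs H = map_prod h h ` parcs G"
  proof
    show "parcs H \<subseteq> map_prod h h ` parcs G"
    proof
      fix e assume e: "e \<in> parcs H"
      then have "e \<in> h ` pverts G \<times> h ` pverts G" using H img by auto
      then obtain u v where uv: "u \<in> pverts G" "v \<in> pverts G" "e = (h u, h v)" by auto
      then have "(u, v) \<in> parcs G" using arcs[of u v] e by simp
      then show "e \<in> map_prod h h ` parcs G" using uv(3) by (auto intro: rev_image_eqI)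
    qed
    show "map_prod h h ` parcs G \<subseteq> parcs H" using arcs wellformed' by auto
  qed
  then have "with_proj H = app_iso f (with_proj G)"
    using img by (simp add: app_iso_def f_def with_proj_def)
  ultimately show ?thesis unfolding digraph_iso_def by blast
qed

lemma digraph_iso_with_projE:
  assumes G: "pair_graph G" and iso: "digraph_iso (with_proj G) (with_proj H)"
  obtains h where "bij_betw h (pverts G) (pverts H)"
    "\<And>u. u \<in> pverts G \<Longrightarrow> nbrs H (h u) = h ` nbrs G u"
proof -
  interpret pair_graph G by fact
  obtain f where f: "pre_digraph.digraph_isomorphism (with_proj G) f"
    and H: "with_proj H = app_iso f (with_proj G)"
    using iso by (auto simp: digraph_iso_def)
  let ?h = "iso_verts f"
  have V: "pverts H = ?h ` pverts G" and A: "parcs H = iso_arcs f ` parcs G"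
    and t: "iso_tail f = fst" and hd: "iso_head f = snd"
    using H by (auto simp: with_proj_def app_iso_def)
  have inj: "inj_on ?h (pverts G)"
    using f by (simp add: pre_digraph.digraph_isomorphism_def)
  have e: "iso_arcs f (u, v) = (?h u, ?h v)" if "(u, v) \<in> parcs G" for u v
    using f that t hd by (fastforce simp: pre_digraph.digraph_isomorphism_def prod_eq_iff)
  have "nbrs H (?h u) = ?h ` nbrs G u" if u: "u \<in> pverts G" for u
  proof
    show "nbrs H (?h u) \<subseteq> ?h ` nbrs G u"
    proof
      fix y assume "y \<in> nbrs H (?h u)"
      then obtain a b where ab: "(a, b) \<in> parcs G" "(?h u, y) = (?h a, ?h b)"
        using A e by (auto simp: nbrs_def)
      then have "a = u" using inj u wellformed'(1)[OF ab(1)] by (auto dest: inj_onD)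
      then show "y \<in> ?h ` nbrs G u" using ab by (auto simp: nbrs_def)
    qed
    show "?h ` nbrs G u \<subseteq> nbrs H (?h u)"
    proof
      fix y assume "y \<in> ?h ` nbrs G u"
      then obtain b where "(u, b) \<in> parcs G" "y = ?h b" by (auto simp: nbrs_def)
      then show "y \<in> nbrs H (?h u)" using A e by (force simp: nbrs_def)
    qed
  qed
  then show ?thesis using that[of ?h] inj V by (auto simp: bij_betw_def)
qed

lemma q_spectrum_iso:
  assumes G: "pair_graph G" and iso: "digraph_iso (with_proj G) (with_proj H)"
  shows "q_spectrum G = q_spectrum H"
proof -
  interpret pair_graph G by fact
  obtain h where bij: "bij_betw h (pverts G) (pverts H)"
    and nb: "\<And>u. u \<in> pverts G \<Longrightarrow> nbrs H (h u) = h ` nbrs G u"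
    using digraph_iso_with_projE[OF G iso] by blast
  have inj: "inj_on h (pverts G)" and V: "pverts H = h ` pverts G"
    using bij by (auto simp: bij_betw_def)
  have sum: "(\<Sum>v\<in>nbrs H (h u). y (h u) + y v) = (\<Sum>v\<in>nbrs G u. y (h u) + y (h v))"
    if "u \<in> pverts G" for u and y :: "_ \<Rightarrow> real"
    unfolding nb[OF that]
    by (subst sum.reindex) (use inj nbrs_subset in \<open>auto intro: inj_on_subset\<close>)
  show ?thesis
  proof (intro equalityI subsetI)
    fix c assume "c \<in> q_spectrum H"
    then obtain y where y: "\<exists>v\<in>pverts H. y v \<noteq> 0"
      "\<forall>u\<in>pverts H. (\<Sum>v\<in>nbrs H u. y u + y v) = c * y u" by (auto simp: q_spectrum_def)
    have "(\<exists>v\<in>pverts G. (y \<circ> h) v \<noteq> 0) \<and>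
      (\<forall>u\<in>pverts G. (\<Sum>v\<in>nbrs G u. (y \<circ> h) u + (y \<circ> h) v) = c * (y \<circ> h) u)"
      using y V sum[of _ y] by auto
    then show "c \<in> q_spectrum G" unfolding q_spectrum_def by blast
  next
    fix c assume "c \<in> q_spectrum G"
    then obtain x where x: "\<exists>v\<in>pverts G. x v \<noteq> 0"
      "\<forall>u\<in>pverts G. (\<Sum>v\<in>nbrs G u. x u + x v) = c * x u" by (auto simp: q_spectrum_def)
    define y where "y = x \<circ> the_inv_into (pverts G) h"
    have yh: "y (h u) = x u" if "u \<in> pverts G" for u
      using inj that by (simp add: y_def the_inv_into_f_f)
    have "(\<Sum>v\<in>nbrs G u. y (h u) + y (h v)) = (\<Sum>v\<in>nbrs G u. x u + x v)" if "u \<in> pverts G" for u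
      using that nbrs_subset[of u] by (intro sum.cong) (auto simp: yh subset_iff)
    then have "(\<exists>v\<in>pverts H. y v \<noteq> 0) \<and>
      (\<forall>u\<in>pverts H. (\<Sum>v\<in>nbrs H u. y u + y v) = c * y u)"
      using x V sum[of _ y] by (auto simp: yh)
    then show "c \<in> q_spectrum H" unfolding q_spectrum_def by blast
  qed
qed

section \<open>Shortest odd closed walks\<close>

definition closed_walk :: "'a pair_pre_digraph \<Rightarrow> (nat \<Rightarrow> 'a) \<Rightarrow> nat \<Rightarrow> bool" where
  "closed_walk G f g \<longleftrightarrow> f g = f 0 \<and> (\<forall>i<g. (f i, f (Suc i)) \<in> parcs G)"

text \<open>Adjacency in the cycle on \<open>0, ..., L - 1\<close>. The vertices of
  \<open>cycle_graph\<close> start at 1, hence the later shifts by one.\<close>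

definition cyc_adj :: "nat \<Rightarrow> nat \<Rightarrow> nat \<Rightarrow> bool" where
  "cyc_adj L i j \<longleftrightarrow> j = Suc i mod L \<or> i = Suc j mod L"

text \<open>Two points cut a closed walk into complementary arcs. For odd \<open>g\<close> their
  lengths have opposite parity, so any further walk between the points closes up with one of them to
  an odd closed walk.\<close>

lemma closed_walk_relpow:
  assumes f: "closed_walk G f g" and "i \<le> j" "j \<le> g"
  shows "(f i, f j) \<in> parcs G ^^ (j - i)" "(f j, f i) \<in> parcs G ^^ (g - (j - i))"
proof -
  have seg: "(f a, f b) \<in> parcs G ^^ (b - a)" if "a \<le> b" "b \<le> g" for a b
    unfolding relpow_fun_conv
    by (rule exI[of _ "\<lambda>l. f (a + l)"]) (use that f in \<open>auto simp: closed_walk_def\<close>)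
  show "(f i, f j) \<in> parcs G ^^ (j - i)" using seg assms by simp
  have "(f j, f g) \<in> parcs G ^^ (g - j)" "(f 0, f i) \<in> parcs G ^^ (i - 0)"
    using assms by (intro seg; simp)+
  then have "(f j, f i) \<in> parcs G ^^ ((g - j) + i)"
    using f by (auto simp: relpow_add closed_walk_def)
  also have "(g - j) + i = g - (j - i)" using assms by simp
  finally show "(f j, f i) \<in> parcs G ^^ (g - (j - i))" .
qed

text \<open>A repeated vertex would split the walk into two shorter closed walks, one of them
  odd.\<close>

lemma closed_walk_shortest_odd_inj:
  assumes f: "closed_walk G f g" and "odd g"
    and least: "\<And>u n. odd n \<Longrightarrow> (u, u) \<in> parcs G ^^ n \<Longrightarrow> g \<le> n"
  shows "inj_on f {..<g}"
proof (rule linorder_inj_onI)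
  fix i j assume ij: "i < j" "i \<in> {..<g}" "j \<in> {..<g}"
  show "f i \<noteq> f j"
  proof
    assume eq: "f i = f j"
    have "(f i, f i) \<in> parcs G ^^ (j - i)" "(f i, f i) \<in> parcs G ^^ (g - (j - i))"
      using closed_walk_relpow[OF f, of i j] ij eq by auto
    moreover have "odd (j - i) \<or> odd (g - (j - i))" using \<open>odd g\<close> ij by auto
    ultimately have "g \<le> j - i \<or> g \<le> g - (j - i)" using least by blast
    then show False using ij by auto
  qed
qed auto

lemma contains_cycle_graphI:
  assumes G: "pair_graph G" and f: "closed_walk G f g" and inj: "inj_on f {..<g}" and "g \<ge> 3"
  shows "contains_graph G (cycle_graph g)"
proof -
  interpret pair_graph G by fact
  define S where "S = \<lparr>pverts = f ` {..<g}, parcs = {(f a, f b) |a b. a < g \<and> b < g \<and> cyc_adj g a b}\<rparr>"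
  have step: "(f a, f (Suc a mod g)) \<in> parcs G" if "a < g" for a
    using that f by (cases "Suc a = g") (auto simp: closed_walk_def)
  have "parcs S \<subseteq> parcs G"
    using step arcs_symmetric by (auto simp: S_def cyc_adj_def)
  moreover have "pverts S \<subseteq> pverts G"
    using step wellformed'(1) by (auto simp: S_def)
  moreover have S: "pair_wf_digraph S"
    by unfold_locales (auto simp: S_def)
  ultimately have "subgraph (with_proj S) (with_proj G)"
    using wf_digraph_axioms
    by (simp add: subgraph_def compatible_def wf_digraph_wp_iff)
  moreover have "digraph_iso (with_proj S) (with_proj (cycle_graph g))"
  proof (rule digraph_iso_with_projI[OF S])
    define h where "h = (\<lambda>v. Suc (the_inv_into {..<g} f v))"
    have h: "h (f a) = Suc a" if "a < g" for a
      using inj that by (simp add: h_def the_inv_into_f_f)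
    have cyc: "(Suc a, Suc b) \<in> parcs (cycle_graph g) \<longleftrightarrow> cyc_adj g a b" if "a < g" "b < g" for a b
      using that by (auto simp: cycle_graph_def cyc_adj_def)
    show "bij_betw h (pverts S) (pverts (cycle_graph g))"
      unfolding bij_betw_def
    proof
      show "inj_on h (pverts S)" by (auto simp: S_def inj_on_def h)
      have "h ` pverts S = Suc ` {..<g}" by (auto simp: S_def h image_image)
      also have "\<dots> = {1..g}" by (simp add: lessThan_atLeast0 image_Suc_atLeastLessThan atLeastLessThanSuc_atLeastAtMost)
      finally show "h ` pverts S = pverts (cycle_graph g)" by (simp add: cycle_graph_def)
    qed
    show "(h u, h v) \<in> parcs (cycle_graph g) \<longleftrightarrow> (u, v) \<in> parcs S" if uv: "u \<in> pverts S" "v \<in> pverts S" for u v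
    proof -
      obtain a b where ab: "a < g" "b < g" "u = f a" "v = f b" using uv by (auto simp: S_def)
      have "(f a, f b) \<in> parcs S \<longleftrightarrow> cyc_adj g a b"
        using ab inj_on_eq_iff[OF inj] by (auto simp: S_def)
      then show ?thesis using ab by (simp add: h cyc)
    qed
    show "parcs (cycle_graph g) \<subseteq> pverts (cycle_graph g) \<times> pverts (cycle_graph g)"
      by (auto simp: cycle_graph_def)
  qed
  ultimately show ?thesis unfolding contains_graph_def by blast
qed

context pair_graph
begin

lemma relpow_parcs_sym: "(u, v) \<in> parcs G ^^ n \<longleftrightarrow> (v, u) \<in> parcs G ^^ n"
proof -
  have "(b, a) \<in> parcs G ^^ n" if "(a, b) \<in> parcs G ^^ n" for a b
    using that
  proof (induction n arbitrary: b)
    case (Suc n)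
    then obtain c where "(a, c) \<in> parcs G ^^ n" "(c, b) \<in> parcs G" by auto
    then show ?case using Suc.IH arcs_symmetric by (blast intro: relpow_Suc_I2)
  qed simp
  then show ?thesis by blast
qed

text \<open>Colour each vertex by the parity of a walk from the representative of its component.
  Without odd closed walks this parity is well defined and changes along every edge.\<close>

lemma odd_closed_walk_if_not_bipartite:
  assumes "\<not> bipartite G"
  shows "\<exists>u n. odd n \<and> (u, u) \<in> parcs G ^^ n"
proof (rule ccontr)
  assume "\<not> ?thesis"
  then have none: "even n" if "(u, u) \<in> parcs G ^^ n" for u n using that by blast
  \<comment> \<open>\<open>SOME\<close> gives the same value for equal predicates, so
    \<open>rep\<close> is constant along edges.\<close>
  define rep where "rep u = (SOME v. (v, u) \<in> (parcs G)\<^sup>*)" for u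
  define U where "U = {u \<in> pverts G. \<exists>n. even n \<and> (rep u, u) \<in> parcs G ^^ n}"
  have rep: "\<exists>n. (rep u, u) \<in> parcs G ^^ n" for u
  proof -
    have "(rep u, u) \<in> (parcs G)\<^sup>*" unfolding rep_def by (rule someI[of _ u]) simp
    then show ?thesis by (rule rtrancl_imp_relpow)
  qed
  have rep_eq: "rep u = rep v" if "(u, v) \<in> parcs G" for u v
  proof -
    have "(w, u) \<in> (parcs G)\<^sup>* \<longleftrightarrow> (w, v) \<in> (parcs G)\<^sup>*" for w
      using that arcs_symmetric[OF that] by (meson rtrancl.rtrancl_into_rtrancl)
    then show ?thesis by (simp add: rep_def)
  qed
  have parity: "even a \<longleftrightarrow> odd b"
    if "(u, v) \<in> parcs G" "(rep u, u) \<in> parcs G ^^ a" "(rep v, v) \<in> parcs G ^^ b" for u v a b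
  proof -
    have "(rep u, v) \<in> parcs G ^^ Suc a" using that by auto
    moreover have "(v, rep u) \<in> parcs G ^^ b" using that rep_eq[OF that(1)] relpow_parcs_sym by simp
    ultimately have "(rep u, rep u) \<in> parcs G ^^ (Suc a + b)" by (auto simp only: relpow_add)
    then show ?thesis using none[of "rep u" "Suc a + b"] by simp
  qed
  have "u \<in> U \<longleftrightarrow> v \<notin> U" if "(u, v) \<in> parcs G" for u v
  proof -
    obtain a b where ab: "(rep u, u) \<in> parcs G ^^ a" "(rep v, v) \<in> parcs G ^^ b"
      using rep by blast
    have "u \<in> U \<longleftrightarrow> even a"
      using parity[OF that _ ab(2)] ab(1) wellformed'(1)[OF that] by (auto simp: U_def)
    moreover have "v \<in> U \<longleftrightarrow> even b"
      using parity[OF that ab(1)] ab(2) wellformed'(2)[OF that] by (auto simp: U_def)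
    ultimately show ?thesis using parity[OF that ab] by simp
  qed
  then have "parcs G \<subseteq> U \<times> (pverts G - U) \<union> (pverts G - U) \<times> U"
    using wellformed' by auto
  moreover have "pverts G = U \<union> (pverts G - U)" by (auto simp: U_def)
  ultimately have "bipartite G" unfolding bipartite_def by blast
  then show False using assms by simp
qed

text \<open>A shortest odd closed walk is a cycle, so its length avoids the excluded range, and
  parity lifts it to \<open>2 * k + 3\<close>.\<close>

lemma shortest_odd_closed_walk:
  assumes nb: "\<not> bipartite G"
    and free: "\<forall>l. odd l \<and> 3 \<le> l \<and> l \<le> 2 * k + 1 \<longrightarrow> \<not> contains_graph G (cycle_graph l)"
  obtains f g where "closed_walk G f g" "odd g" "2 * k + 3 \<le> g"
    "\<And>u n. odd n \<Longrightarrow> (u, u) \<in> parcs G ^^ n \<Longrightarrow> g \<le> n"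
proof -
  define P where "P n \<longleftrightarrow> odd n \<and> (\<exists>u. (u, u) \<in> parcs G ^^ n)" for n
  define g where "g = (LEAST n. P n)"
  have "\<exists>n. P n" using odd_closed_walk_if_not_bipartite[OF nb] by (auto simp: P_def)
  then have "P g" unfolding g_def by (rule LeastI_ex)
  then obtain u where g: "odd g" "(u, u) \<in> parcs G ^^ g" by (auto simp: P_def)
  have least: "g \<le> n" if "odd n" "(u, u) \<in> parcs G ^^ n" for u n
    unfolding g_def using that by (intro Least_le) (auto simp: P_def)
  obtain f where "f 0 = u" "f g = u" "\<forall>i<g. (f i, f (Suc i)) \<in> parcs G"
    using g(2) unfolding relpow_fun_conv by blast
  then have f: "closed_walk G f g" by (simp add: closed_walk_def)
  have "g \<noteq> 1" using g(2) pair_no_loops[of "(u, u)"] by auto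
  then have "g \<ge> 3" using g(1) by (cases "g = 0"; cases "g = 2") auto
  then have "contains_graph G (cycle_graph g)"
    using contains_cycle_graphI[OF pair_graph_axioms f] closed_walk_shortest_odd_inj[OF f g(1)] least
    by blast
  then have "\<not> g \<le> 2 * k + 1" using free g(1) \<open>g \<ge> 3\<close> by blast
  then have "2 * k + 3 \<le> g" using g(1) by (cases "g = 2 * k + 2") auto
  then show ?thesis using that[OF f g(1)] least by blast
qed

end

text \<open>For \<open>k >= 2\<close> the odd girth is at least 7, which keeps the cycle vertices 4
  and \<open>g - 1\<close>, the two neighbours of the window 0 to 3, distinct.\<close>

locale odd_girth_graph = pair_graph +
  fixes g :: nat
  assumes g_ge_7: "7 \<le> g" and odd_g: "odd g"
    and odd_closed_walk_ge: "\<And>u n. odd n \<Longrightarrow> (u, u) \<in> parcs G ^^ n \<Longrightarrow> g \<le> n"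
begin

text \<open>Two walks with the same ends and opposite parity form an odd closed walk. Every
  structural fact below is a comparison of this kind.\<close>

lemma relpow_odd_parity:
  assumes "(u, v) \<in> parcs G ^^ a" "(u, v) \<in> parcs G ^^ b" "odd (a + b)"
  shows "g \<le> a + b"
proof -
  have "(v, u) \<in> parcs G ^^ b" using assms(2) relpow_parcs_sym by blast
  then have "(u, u) \<in> parcs G ^^ (a + b)" using assms(1) by (auto simp: relpow_add)
  then show ?thesis using assms(3) odd_closed_walk_ge by blast
qed

lemma no_triangle: "u \<in> nbrs G v \<Longrightarrow> w \<in> nbrs G v \<Longrightarrow> w \<notin> nbrs G u"
proof
  assume "u \<in> nbrs G v" "w \<in> nbrs G v" "w \<in> nbrs G u"
  then have "(v, w) \<in> parcs G ^^ 2" "(v, w) \<in> parcs G ^^ 1"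
    by (auto simp: nbrs_def numeral_2_eq_2)
  from relpow_odd_parity[OF this] show False using g_ge_7 by simp
qed

context
  fixes f assumes f: "closed_walk G f g"
begin

lemma inj_f: "inj_on f {..<g}"
  using closed_walk_shortest_odd_inj[OF f odd_g] odd_closed_walk_ge by blast

lemma f_verts: "f ` {..<g} \<subseteq> pverts G"
  using f wellformed'(1) by (auto simp: closed_walk_def)

text \<open>In each parity case the walk of length \<open>l\<close> is combined with the arc of the
  cycle whose parity differs from that of \<open>l\<close>.\<close>

lemma relpow_between:
  assumes ij: "i < j" "j < g" and w: "(f i, f j) \<in> parcs G ^^ l"
  shows "odd l \<Longrightarrow> odd (j - i) \<Longrightarrow> j - i \<le> l" "odd l \<Longrightarrow> even (j - i) \<Longrightarrow> g \<le> j - i + l"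
    "even l \<Longrightarrow> odd (j - i) \<Longrightarrow> g \<le> j - i + l" "even l \<Longrightarrow> even (j - i) \<Longrightarrow> j - i \<le> l"
proof -
  have s: "(f i, f j) \<in> parcs G ^^ (j - i)" "(f i, f j) \<in> parcs G ^^ (g - (j - i))"
    using closed_walk_relpow[OF f, of i j] ij relpow_parcs_sym by auto
  show "odd l \<Longrightarrow> odd (j - i) \<Longrightarrow> j - i \<le> l" "even l \<Longrightarrow> even (j - i) \<Longrightarrow> j - i \<le> l"
    using relpow_odd_parity[OF s(2) w] odd_g ij by auto
  show "odd l \<Longrightarrow> even (j - i) \<Longrightarrow> g \<le> j - i + l" "even l \<Longrightarrow> odd (j - i) \<Longrightarrow> g \<le> j - i + l"
    using relpow_odd_parity[OF s(1) w] by auto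
qed

lemma chord_free:
  assumes "i < j" "j < g" "f j \<in> nbrs G (f i)"
  shows "j - i = 1 \<or> j - i = g - 1"
proof -
  have "(f i, f j) \<in> parcs G ^^ 1" using assms(3) by (simp add: nbrs_def)
  note * = relpow_between[OF assms(1,2) this]
  show ?thesis using *(1,2) assms by (cases "even (j - i)") auto
qed

lemma common_nbr_dist:
  assumes "i < j" "j < g" "f i \<in> nbrs G v" "f j \<in> nbrs G v"
  shows "j - i = 2 \<or> j - i = g - 2"
proof -
  have "(f i, f j) \<in> parcs G ^^ 2"
    using assms(3,4) nbrs_sym[of "f i" v] by (auto simp: nbrs_def numeral_2_eq_2)
  note * = relpow_between[OF assms(1,2) this]
  show ?thesis
  proof (cases "even (j - i)")
    case True
    then have "j - i \<le> 2" using *(4) by simp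
    moreover have "j - i \<noteq> 1" using True by (metis odd_one)
    ultimately show ?thesis using assms(1) by linarith
  next
    case False
    then have "g \<le> j - i + 2" using *(3) by simp
    moreover have "j - i \<noteq> g - 1" using False odd_g by (metis even_diff_nat odd_one odd_add odd_even_add)
    ultimately show ?thesis using assms(1,2) by linarith
  qed
qed

text \<open>The longer arc between two cycle neighbours of \<open>v\<close> has length
  \<open>g - 2\<close>; going back through \<open>v\<close> gives a shortest odd closed walk that
  visits \<open>v\<close>.\<close>

lemma common_nbr_relpow:
  assumes "x \<in> nbrs G v \<inter> f ` {..<g}" "y \<in> nbrs G v \<inter> f ` {..<g}" "x \<noteq> y"
  shows "(x, y) \<in> parcs G ^^ (g - 2)"
proof -
  have *: "(f i, f j) \<in> parcs G ^^ (g - 2)"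
    if "f i \<in> nbrs G v" "f j \<in> nbrs G v" "i < j" "j < g" for i j
    using common_nbr_dist[OF that(3,4,1,2)]
  proof
    assume "j - i = 2"
    then show ?thesis using closed_walk_relpow(2)[OF f, of i j] that relpow_parcs_sym by simp
  next
    assume "j - i = g - 2"
    then show ?thesis using closed_walk_relpow(1)[OF f, of i j] that by simp
  qed
  obtain i j where ij: "i < g" "j < g" "x = f i" "y = f j" using assms by auto
  then have "i < j \<or> j < i" using assms(3) by (cases i j rule: linorder_cases) auto
  then show ?thesis using *[of i j] *[of j i] relpow_parcs_sym[of x y] ij assms by blast
qed

text \<open>For three neighbours at positions \<open>i < j < l\<close> the differences are all 2 or
  \<open>g - 2\<close>, and two of them add up to the third. The only candidate is
  \<open>2 + 2 = g - 2\<close>, and \<open>g = 6\<close> is even.\<close>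

lemma card_nbrs_on_cycle_le: "card (nbrs G v \<inter> f ` {..<g}) \<le> 2"
proof (rule ccontr)
  let ?I = "{i \<in> {..<g}. f i \<in> nbrs G v}"
  assume "\<not> ?thesis"
  moreover have "nbrs G v \<inter> f ` {..<g} = f ` ?I" by auto
  moreover have "card (f ` ?I) = card ?I"
    by (rule card_image) (rule inj_on_subset[OF inj_f], auto)
  ultimately have "card ?I \<ge> 3" by simp
  then obtain T where T: "T \<subseteq> ?I" "card T = 3" "finite T"
    by (meson obtain_subset_with_card_n)
  define i l where "i = Min T" and "l = Max T"
  have "T \<noteq> {}" using T by auto
  then have il: "i \<in> T" "l \<in> T" using T by (auto simp: i_def l_def)
  have "\<not> T \<subseteq> {i, l}"
  proof
    assume "T \<subseteq> {i, l}"
    then have "card T \<le> card {i, l}" by (intro card_mono) auto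
    also have "\<dots> \<le> 2" by (simp add: card_insert_if)
    finally show False using T by simp
  qed
  then obtain j where j: "j \<in> T" "j \<noteq> i" "j \<noteq> l" by blast
  have "i \<le> j" "j \<le> l" using T j by (auto simp: i_def l_def)
  then have ord: "i < j" "j < l" using j by auto
  have d: "f i \<in> nbrs G v" "f j \<in> nbrs G v" "f l \<in> nbrs G v" "l < g" "j < g"
    using T(1) il j by auto
  have "j - i = 2 \<or> j - i = g - 2" "l - j = 2 \<or> l - j = g - 2" "l - i = 2 \<or> l - i = g - 2"
    using common_nbr_dist ord d by auto
  moreover have "g \<noteq> 6" using odd_g by auto
  ultimately show False using ord \<open>l < g\<close> g_ge_7 by auto
qed

text \<open>Outside the cycle the two neighbourhoods are disjoint, as there is no triangle, so they
  share at most \<open>card (pverts G) - g\<close> vertices. On the cycle each has at most 2.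
  Equality makes all of these bounds tight.\<close>

lemma edge_degree_sum_le:
  assumes uv: "v \<in> nbrs G u"
  shows "card (nbrs G u) + card (nbrs G v) + g \<le> card (pverts G) + 4"
    and "card (nbrs G u) + card (nbrs G v) + g = card (pverts G) + 4 \<Longrightarrow>
      card (nbrs G u \<inter> f ` {..<g}) = 2 \<and> card (nbrs G v \<inter> f ` {..<g}) = 2 \<and>
      pverts G \<subseteq> f ` {..<g} \<union> nbrs G u \<union> nbrs G v"
proof -
  let ?C = "f ` {..<g}"
  have C: "finite ?C" "card ?C = g" using card_image[OF inj_f] by auto
  have split: "card (nbrs G w) = card (nbrs G w \<inter> ?C) + card (nbrs G w - ?C)" for w
    by (subst card_Un_disjoint[symmetric]) (auto intro: arg_cong[of _ _ card])
  have disj: "nbrs G u \<inter> nbrs G v = {}"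
    using no_triangle[of v u] uv by auto
  have sub: "(nbrs G u - ?C) \<union> (nbrs G v - ?C) \<subseteq> pverts G - ?C"
    using nbrs_subset by auto
  have un: "card (nbrs G u - ?C) + card (nbrs G v - ?C) = card ((nbrs G u - ?C) \<union> (nbrs G v - ?C))"
    by (subst card_Un_disjoint) (use disj in auto)
  have "card ((nbrs G u - ?C) \<union> (nbrs G v - ?C)) \<le> card (pverts G - ?C)"
    using sub pair_finite_verts by (intro card_mono) auto
  moreover have "card (pverts G - ?C) + g = card (pverts G)"
    using card_Diff_subset[OF C(1) f_verts] card_mono[OF pair_finite_verts f_verts] C(2) by simp
  moreover note card_nbrs_on_cycle_le[of u] card_nbrs_on_cycle_le[of v] split[of u] split[of v] un
  ultimately show "card (nbrs G u) + card (nbrs G v) + g \<le> card (pverts G) + 4"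
    and "card (nbrs G u) + card (nbrs G v) + g = card (pverts G) + 4 \<Longrightarrow>
      card (nbrs G u \<inter> f ` {..<g}) = 2 \<and> card (nbrs G v \<inter> f ` {..<g}) = 2 \<and>
      pverts G \<subseteq> f ` {..<g} \<union> nbrs G u \<union> nbrs G v"
  proof -
    assume *: "card ((nbrs G u - ?C) \<union> (nbrs G v - ?C)) \<le> card (pverts G - ?C)"
      "card (pverts G - ?C) + g = card (pverts G)"
      "card (nbrs G u \<inter> ?C) \<le> 2" "card (nbrs G v \<inter> ?C) \<le> 2"
      "card (nbrs G u) = card (nbrs G u \<inter> ?C) + card (nbrs G u - ?C)"
      "card (nbrs G v) = card (nbrs G v \<inter> ?C) + card (nbrs G v - ?C)"
      "card (nbrs G u - ?C) + card (nbrs G v - ?C) = card ((nbrs G u - ?C) \<union> (nbrs G v - ?C))"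
    show "card (nbrs G u) + card (nbrs G v) + g \<le> card (pverts G) + 4" using * by linarith
    assume eq: "card (nbrs G u) + card (nbrs G v) + g = card (pverts G) + 4"
    then have "card ((nbrs G u - ?C) \<union> (nbrs G v - ?C)) = card (pverts G - ?C)" using * by linarith
    then have "(nbrs G u - ?C) \<union> (nbrs G v - ?C) = pverts G - ?C"
      using sub pair_finite_verts by (intro card_subset_eq) auto
    moreover have "card (nbrs G u \<inter> ?C) = 2" "card (nbrs G v \<inter> ?C) = 2" using eq * by linarith+
    ultimately show "card (nbrs G u \<inter> ?C) = 2 \<and> card (nbrs G v \<inter> ?C) = 2 \<and>
      pverts G \<subseteq> ?C \<union> nbrs G u \<union> nbrs G v" by blast
  qed
qed

end

end

section \<open>Homomorphisms to a cycle\<close>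

text \<open>A spanning subgraph of a blow-up of the cycle of length \<open>L\<close> is given by its projection to
  the cycle; \<open>m i\<close> is the number of vertices over the cycle vertex \<open>i\<close>.\<close>

definition cyc_hom :: "'a pair_pre_digraph \<Rightarrow> nat \<Rightarrow> ('a \<Rightarrow> nat) \<Rightarrow> (nat \<Rightarrow> nat) \<Rightarrow> bool" where
  "cyc_hom G L \<phi> m \<longleftrightarrow> (\<forall>u\<in>pverts G. \<phi> u < L) \<and> (\<forall>(u, v)\<in>parcs G. cyc_adj L (\<phi> u) (\<phi> v)) \<and>
     (\<forall>i<L. card {u \<in> pverts G. \<phi> u = i} = m i)"

definition cyc_pred :: "nat \<Rightarrow> nat \<Rightarrow> nat" where
  "cyc_pred L i = (if i = 0 then L - 1 else i - 1)"

lemma cyc_position_cases: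
  assumes "L \<ge> 3" "i < L"
  shows "i = 0 \<and> Suc i mod L = 1 \<and> cyc_pred L i = L - 1 \<or>
    i = L - 1 \<and> Suc i mod L = 0 \<and> cyc_pred L i = L - 2 \<or>
    0 < i \<and> i < L - 1 \<and> Suc i mod L = Suc i \<and> cyc_pred L i = i - 1"
proof -
  consider "i = 0" | "i = L - 1" "i > 0" | "0 < i" "i < L - 1" using assms by linarith
  then show ?thesis using assms by cases (auto simp: cyc_pred_def)
qed

text \<open>The inequality \<open>Q w <= q w\<close> on the complete blow-up with class sizes
  \<open>m\<close>, for weights that are constant on classes.\<close>

definition cyc_supersolution :: "nat \<Rightarrow> (nat \<Rightarrow> nat) \<Rightarrow> real \<Rightarrow> (nat \<Rightarrow> real) \<Rightarrow> bool" where
  "cyc_supersolution L m q W \<longleftrightarrow> (\<forall>i<L. W i > 0 \<and>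
     real (m (Suc i mod L)) * (W i + W (Suc i mod L)) + real (m (cyc_pred L i)) * (W i + W (cyc_pred L i))
       \<le> q * W i)"

lemma cyc_supersolutionI:
  fixes W :: "nat \<Rightarrow> real" and q :: real
  assumes L: "L \<ge> 3" and pos: "\<And>i. i < L \<Longrightarrow> W i > 0"
    and first: "real (m 1) * (W 0 + W 1) + real (m (L - 1)) * (W 0 + W (L - 1)) \<le> q * W 0"
    and last: "real (m 0) * (W (L - 1) + W 0) + real (m (L - 2)) * (W (L - 1) + W (L - 2)) \<le> q * W (L - 1)"
    and mid: "\<And>i. 0 < i \<Longrightarrow> i < L - 1 \<Longrightarrow>
      real (m (Suc i)) * (W i + W (Suc i)) + real (m (i - 1)) * (W i + W (i - 1)) \<le> q * W i"
  shows "cyc_supersolution L m q W"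
  unfolding cyc_supersolution_def
proof (intro allI impI conjI pos)
  fix i assume "i < L"
  then show "real (m (Suc i mod L)) * (W i + W (Suc i mod L))
      + real (m (cyc_pred L i)) * (W i + W (cyc_pred L i)) \<le> q * W i"
    using cyc_position_cases[OF L, of i] first last mid[of i] by auto
qed

lemma cyc_adj_iff:
  assumes "i < L" "j < L"
  shows "cyc_adj L i j \<longleftrightarrow> j = Suc i mod L \<or> j = cyc_pred L i"
  using assms by (cases "Suc j = L") (auto simp: cyc_adj_def cyc_pred_def)

lemma cyc_adj_commute: "cyc_adj L i j \<longleftrightarrow> cyc_adj L j i"
  by (auto simp: cyc_adj_def)

lemma cyc_adj_Suc: "Suc i < L \<Longrightarrow> cyc_adj L i (Suc i)"
  by (simp add: cyc_adj_def)

lemma cyc_adj_last: "0 < L \<Longrightarrow> cyc_adj L 0 (L - 1)"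
  by (simp add: cyc_adj_def)

context pair_graph
begin

lemma cyc_hom_sum:
  assumes hom: "cyc_hom G L \<phi> m" and L: "L \<ge> 3" and u: "u \<in> pverts G"
  shows "(\<Sum>v | v \<in> pverts G \<and> cyc_adj L (\<phi> u) (\<phi> v). W (\<phi> u) + W (\<phi> v)) =
    real (m (Suc (\<phi> u) mod L)) * (W (\<phi> u) + W (Suc (\<phi> u) mod L)) +
    real (m (cyc_pred L (\<phi> u))) * (W (\<phi> u) + W (cyc_pred L (\<phi> u)))"
proof -
  define cls where "cls i = {u \<in> pverts G. \<phi> u = i}" for i
  let ?s = "Suc (\<phi> u) mod L" and ?p = "cyc_pred L (\<phi> u)"
  have \<phi>: "\<phi> v < L" if "v \<in> pverts G" for v using hom that by (simp add: cyc_hom_def)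
  have sp: "?s \<noteq> ?p" "?s < L" "?p < L"
    using cyc_position_cases[OF L \<phi>[OF u]] L by auto
  have "{v. v \<in> pverts G \<and> cyc_adj L (\<phi> u) (\<phi> v)} = cls ?s \<union> cls ?p"
    using cyc_adj_iff[OF \<phi>[OF u] \<phi>] by (auto simp: cls_def)
  then have "(\<Sum>v | v \<in> pverts G \<and> cyc_adj L (\<phi> u) (\<phi> v). W (\<phi> u) + W (\<phi> v)) =
      (\<Sum>v\<in>cls ?s. W (\<phi> u) + W (\<phi> v)) + (\<Sum>v\<in>cls ?p. W (\<phi> u) + W (\<phi> v))"
    using pair_finite_verts sp(1) by (simp only:) (intro sum.union_disjoint, auto simp: cls_def)
  also have "\<dots> = card (cls ?s) * (W (\<phi> u) + W ?s) + card (cls ?p) * (W (\<phi> u) + W ?p)"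
    by (simp add: cls_def)
  finally show ?thesis using hom sp by (simp add: cyc_hom_def cls_def)
qed

text \<open>Missing edges only lower the sums, because the weights are positive, so one
  \<open>W\<close> serves all spanning subgraphs. For \<open>c = q\<close> no edge is missing at the
  vertices of \<open>M\<close>; hence \<open>M\<close> contains the whole next class and, all
  classes being nonempty, spreads around the cycle.\<close>

lemma cyc_hom_supersolution:
  assumes hom: "cyc_hom G L \<phi> m" and "L \<ge> 3" and W: "cyc_supersolution L m q W"
    and c: "c \<in> q_spectrum G"
  shows "c \<le> q"
    and "c = q \<Longrightarrow> (\<And>i. i < L \<Longrightarrow> 0 < m i) \<Longrightarrow> u \<in> pverts G \<Longrightarrow> v \<in> pverts G \<Longrightarrow>
      cyc_adj L (\<phi> u) (\<phi> v) \<Longrightarrow> (u, v) \<in> parcs G"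
proof -
  define cls where "cls i = {u \<in> pverts G. \<phi> u = i}" for i
  define B where "B u = {v. v \<in> pverts G \<and> cyc_adj L (\<phi> u) (\<phi> v)}" for u
  define w where "w = W \<circ> \<phi>"
  have \<phi>: "\<phi> u < L" if "u \<in> pverts G" for u using hom that by (simp add: cyc_hom_def)
  have pos: "w u > 0" if "u \<in> pverts G" for u
    using W \<phi>[OF that] by (simp add: w_def cyc_supersolution_def)
  have BV: "B u \<subseteq> pverts G" for u by (auto simp: B_def)
  have sub: "nbrs G u \<subseteq> B u" if "u \<in> pverts G" for u
    using hom nbrs_subset by (auto simp: cyc_hom_def nbrs_def B_def)
  have sumB: "(\<Sum>v\<in>B u. w u + w v) \<le> q * w u" if u: "u \<in> pverts G" for u
    unfolding B_def w_def comp_def cyc_hom_sum[OF hom \<open>L \<ge> 3\<close> u]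
    using W \<phi>[OF u] by (simp add: cyc_supersolution_def)
  have finB: "finite (B u)" for u using pair_finite_verts by (simp add: B_def)
  have nonneg: "w u + w v > 0" if "u \<in> pverts G" "v \<in> B u" for u v
  proof -
    have "v \<in> pverts G" using BV that(2) by blast
    then show ?thesis using pos[OF that(1)] pos[of v] by linarith
  qed
  have super: "(\<Sum>v\<in>nbrs G u. w u + w v) \<le> q * w u" if "u \<in> pverts G" for u
  proof -
    have "(\<Sum>v\<in>nbrs G u. w u + w v) \<le> (\<Sum>v\<in>B u. w u + w v)"
      using sub[OF that] finB nonneg[OF that] by (intro sum_mono2) (auto intro: less_imp_le)
    then show ?thesis using sumB[OF that] by linarith
  qed
  note bound = q_spectrum_le_supersolution[of c w q, OF c pos super]
  show "c \<le> q" using bound(1) by blast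
  assume "c = q" and mpos: "\<And>i. i < L \<Longrightarrow> 0 < m i"
    and uv: "u \<in> pverts G" "v \<in> pverts G" "cyc_adj L (\<phi> u) (\<phi> v)"
  have "\<exists>M\<subseteq>pverts G. M \<noteq> {} \<and>
      (\<forall>u\<in>M. nbrs G u \<subseteq> M \<and> (\<Sum>v\<in>nbrs G u. w u + w v) = q * w u)"
    using bound(2) \<open>c = q\<close> by blast
  then obtain M where M: "M \<subseteq> pverts G" "M \<noteq> {}" "\<And>u. u \<in> M \<Longrightarrow> nbrs G u \<subseteq> M"
    "\<And>u. u \<in> M \<Longrightarrow> (\<Sum>v\<in>nbrs G u. w u + w v) = q * w u" by blast
  have full: "nbrs G u = B u" if u: "u \<in> M" for u
  proof (rule ccontr)
    assume "nbrs G u \<noteq> B u"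
    moreover have "u \<in> pverts G" using u M by blast
    ultimately obtain b where b: "b \<in> B u - nbrs G u" using sub by blast
    have "(\<Sum>v\<in>nbrs G u. w u + w v) < (\<Sum>v\<in>B u. w u + w v)"
      using finB sub[OF \<open>u \<in> pverts G\<close>] b nonneg[OF \<open>u \<in> pverts G\<close>]
      by (intro sum_strict_mono2[of _ _ b]) (auto intro: less_imp_le)
    then show False using sumB[OF \<open>u \<in> pverts G\<close>] M(4)[OF u] by linarith
  qed
  obtain u0 where u0: "u0 \<in> M" using M(2) by blast
  have next_cls: "cls (Suc (\<phi> u) mod L) \<subseteq> M" if "u \<in> M" for u
    using full[OF that] M(3)[OF that] by (auto simp: B_def cls_def cyc_adj_def)
  have around: "cls ((\<phi> u0 + Suc j) mod L) \<subseteq> M" for j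
  proof (induction j)
    case 0
    then show ?case using next_cls[OF u0] by simp
  next
    case (Suc j)
    let ?i = "(\<phi> u0 + Suc j) mod L"
    have "?i < L" using \<open>L \<ge> 3\<close> by simp
    then have "card (cls ?i) > 0" using hom mpos[of ?i] by (simp add: cyc_hom_def cls_def)
    then obtain z where z: "z \<in> cls ?i" by (metis card_gt_0_iff ex_in_conv)
    then have "\<phi> z = ?i" "z \<in> M" using Suc by (auto simp: cls_def)
    then show ?case using next_cls[of z] by (simp add: mod_Suc_eq)
  qed
  have "u \<in> M"
  proof -
    have "\<phi> u0 < L" "\<phi> u < L" using \<phi> u0 M(1) uv by auto
    \<comment> \<open>The number of forward steps from the class of \<open>u0\<close> to that of
      \<open>u\<close>, with \<open>L\<close> added so that the subtractions stay exact and the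
      count is positive.\<close>
    then have "\<phi> u0 + Suc (L - \<phi> u0 + \<phi> u - 1) = \<phi> u + L" by simp
    then have "(\<phi> u0 + Suc (L - \<phi> u0 + \<phi> u - 1)) mod L = \<phi> u" using \<open>\<phi> u < L\<close> by simp
    then show ?thesis using around[of "L - \<phi> u0 + \<phi> u - 1"] uv(1) by (auto simp: cls_def)
  qed
  then show "(u, v) \<in> parcs G" using full uv(2,3) by (auto simp: nbrs_def B_def)
qed

lemma cyc_hom_automorphism:
  assumes hom: "cyc_hom G L \<phi> m"
    and \<sigma>: "\<And>i. i < L \<Longrightarrow> \<sigma> i < L \<and> \<tau> (\<sigma> i) = i" "\<And>i. i < L \<Longrightarrow> \<tau> i < L \<and> \<sigma> (\<tau> i) = i"
    and adj: "\<And>i. i < L \<Longrightarrow> cyc_adj L (\<sigma> i) (\<sigma> (Suc i mod L))"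
    and m': "\<And>i. i < L \<Longrightarrow> m' i = m (\<tau> i)"
  shows "cyc_hom G L (\<sigma> \<circ> \<phi>) m'"
proof -
  have \<phi>: "\<phi> u < L" if "u \<in> pverts G" for u using hom that by (simp add: cyc_hom_def)
  have "cyc_adj L (\<sigma> (\<phi> u)) (\<sigma> (\<phi> v))" if "(u, v) \<in> parcs G" for u v
  proof -
    have "cyc_adj L (\<phi> u) (\<phi> v)" using hom that by (auto simp: cyc_hom_def)
    then show ?thesis
      using adj \<phi>[OF wellformed'(1)[OF that]] \<phi>[OF wellformed'(2)[OF that]] cyc_adj_commute
      by (metis cyc_adj_def)
  qed
  moreover have "card {u \<in> pverts G. \<sigma> (\<phi> u) = i} = m' i" if "i < L" for i
  proof -
    have "{u \<in> pverts G. \<sigma> (\<phi> u) = i} = {u \<in> pverts G. \<phi> u = \<tau> i}" using \<sigma> \<phi> that by auto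
    then show ?thesis using hom m'[OF that] \<sigma>(2)[OF that] by (simp add: cyc_hom_def)
  qed
  ultimately show ?thesis using \<sigma> \<phi> by (auto simp: cyc_hom_def)
qed

lemma cyc_hom_rotate:
  assumes hom: "cyc_hom G L \<phi> m" and "L \<ge> 3"
  shows "cyc_hom G L ((\<lambda>i. Suc i mod L) \<circ> \<phi>) (\<lambda>i. m (cyc_pred L i))"
    and "cyc_hom G L (cyc_pred L \<circ> \<phi>) (\<lambda>i. m (Suc i mod L))"
proof -
  let ?s = "\<lambda>i. Suc i mod L" and ?t = "cyc_pred L"
  have s: "?s i < L \<and> ?t (?s i) = i" if "i < L" for i
    using that by (cases "Suc i = L") (auto simp: cyc_pred_def)
  have t: "?t i < L \<and> ?s (?t i) = i" if "i < L" for i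
    using that by (auto simp: cyc_pred_def)
  show "cyc_hom G L (?s \<circ> \<phi>) (\<lambda>i. m (cyc_pred L i))"
    by (rule cyc_hom_automorphism[OF hom, where \<tau> = ?t]) (use s t in \<open>auto simp: cyc_adj_def\<close>)
  have "cyc_adj L (?t i) (?t (?s i))" if "i < L" for i
  proof -
    have "Suc (?t i) mod L = i" "?t (?s i) = i" using s t that by blast+
    then show ?thesis by (simp add: cyc_adj_def)
  qed
  then show "cyc_hom G L (?t \<circ> \<phi>) (\<lambda>i. m (Suc i mod L))"
    by (intro cyc_hom_automorphism[OF hom, where \<tau> = ?s]) (use s t in auto)
qed

text \<open>This is the reflection \<open>i \<mapsto> 3 - i\<close> modulo \<open>L\<close>, which
  reverses the window of classes 0 to 3.\<close>

lemma cyc_hom_reflect: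
  assumes hom: "cyc_hom G L \<phi> m" and "L > 3"
  shows "cyc_hom G L ((\<lambda>i. if i \<le> 3 then 3 - i else L + 3 - i) \<circ> \<phi>)
    (\<lambda>i. if i \<le> 3 then m (3 - i) else m (L + 3 - i))"
proof (rule cyc_hom_automorphism[OF hom, where \<tau> = "\<lambda>i. if i \<le> 3 then 3 - i else L + 3 - i"])
  fix i assume i: "i < L"
  consider "Suc i = L" "i > 3" | "Suc i = L" "i = 3" | "Suc i < L" "i \<le> 2" | "Suc i < L" "i = 3" | "Suc i < L" "i > 3"
    using i \<open>L > 3\<close> by linarith
  then show "cyc_adj L (if i \<le> 3 then 3 - i else L + 3 - i)
     (if Suc i mod L \<le> 3 then 3 - Suc i mod L else L + 3 - Suc i mod L)"
    using \<open>L > 3\<close> by cases (auto simp: cyc_adj_def)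
qed (use \<open>L > 3\<close> in auto)

end

section \<open>Projection onto the cycle along an edge of maximal degree sum\<close>

definition four_sizes :: "nat \<Rightarrow> nat \<Rightarrow> nat \<Rightarrow> nat \<Rightarrow> nat \<Rightarrow> nat" where
  "four_sizes a b c d i = (if i = 0 then a else if i = 1 then b else if i = 2 then c
     else if i = 3 then d else 1)"

context odd_girth_graph
begin

text \<open>Reroute twice: \<open>u\<close> has two neighbours on the given cycle and can replace
  the vertex between them. On the new cycle \<open>v\<close> again has two neighbours, one of which
  is \<open>u\<close>, and replaces the vertex between those.\<close>

lemma full_edge_closed_walk:
  assumes f: "closed_walk G f g" and uv: "v \<in> nbrs G u"
    and full: "card (nbrs G u) + card (nbrs G v) + g = card (pverts G) + 4"
  shows "\<exists>f. closed_walk G f g \<and> f 1 = u \<and> f 2 = v"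
proof -
  obtain x y where xy: "x \<noteq> y" "nbrs G u \<inter> f ` {..<g} = {x, y}"
    using edge_degree_sum_le(2)[OF f uv full] by (auto simp: card_2_iff)
  then have walk: "(x, y) \<in> parcs G ^^ (g - 2)"
    by (intro common_nbr_relpow[OF f, of _ u]) auto
  have "(u, x) \<in> parcs G" "(y, u) \<in> parcs G"
    using xy(2) nbrs_sym[of y u] by (auto simp: nbrs_def)
  then have "(u, u) \<in> parcs G ^^ (Suc (Suc (g - 2)))"
    using relpow_Suc_I[OF relpow_Suc_I2[OF _ walk]] by blast
  then have "(u, u) \<in> parcs G ^^ g" using g_ge_7 by (simp add: numeral_2_eq_2 Suc_diff_Suc del: relpow.simps)
  then obtain f1 where f1: "f1 0 = u" "closed_walk G f1 g"
    unfolding relpow_fun_conv closed_walk_def by auto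
  have "u \<in> nbrs G v \<inter> f1 ` {..<g}"
    using f1(1) g_ge_7 uv nbrs_sym[of u v] by (auto intro!: image_eqI[of _ _ 0])
  \<comment> \<open>The equality case applies to any shortest odd closed walk, in particular to the
    rerouted \<open>f1\<close>.\<close>
  moreover have "card (nbrs G v \<inter> f1 ` {..<g}) = 2"
    using edge_degree_sum_le(2)[OF f1(2) uv full] by blast
  ultimately obtain z where z: "z \<in> nbrs G v \<inter> f1 ` {..<g}" "z \<noteq> u"
    by (metis card_2_iff insert_iff)
  then have "(z, u) \<in> parcs G ^^ (g - 2)"
    using \<open>u \<in> nbrs G v \<inter> f1 ` {..<g}\<close> by (intro common_nbr_relpow[OF f1(2), of _ v]) auto
  then have "(v, u) \<in> parcs G ^^ (Suc (g - 2))"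
    using z(1) by (intro relpow_Suc_I2) (auto simp: nbrs_def)
  then obtain p where p: "(v, p) \<in> parcs G ^^ (g - 2)" "(p, u) \<in> parcs G" by (rule relpow_Suc_E)
  obtain h where h: "h 0 = v" "h (g - 2) = p" "\<And>i. i < g - 2 \<Longrightarrow> (h i, h (Suc i)) \<in> parcs G"
    using p(1) unfolding relpow_fun_conv by blast
  \<comment> \<open>The walk starts one step before \<open>u\<close>, so that \<open>u\<close> and
    \<open>v\<close> become the two middle vertices of the window 0 to 3.\<close>
  define f2 where "f2 i = (if i = 0 then p else if i = 1 then u else h (i - 2))" for i
  have "(f2 i, f2 (Suc i)) \<in> parcs G" if "i < g" for i
  proof -
    consider "i = 0" | "i = 1" | "i \<ge> 2" by linarith
    then show ?thesis
    proof cases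
      case 3
      then have "Suc i - 2 = Suc (i - 2)" by simp
      then show ?thesis using h(3)[of "i - 2"] that 3 by (simp add: f2_def)
    qed (use h(1) p(2) uv in \<open>auto simp: f2_def nbrs_def\<close>)
  qed
  then have "closed_walk G f2 g" using h(2) g_ge_7 by (auto simp: closed_walk_def f2_def)
  moreover have "f2 1 = u" "f2 2 = v" using h(1) by (auto simp: f2_def)
  ultimately show ?thesis by blast
qed

lemma full_edge_cyc_hom:
  assumes f0: "closed_walk G f0 g" and uv: "v \<in> nbrs G u"
    and full: "card (nbrs G u) + card (nbrs G v) + g = card (pverts G) + 4"
  shows "\<exists>\<phi> a b c d. cyc_hom G g \<phi> (four_sizes a b c d) \<and> 0 < a \<and> 0 < b \<and> 0 < c \<and> 0 < d \<and>
    a + b + c + d + g = card (pverts G) + 4"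
proof -
  obtain f where f: "closed_walk G f g" and f12: "f 1 = u" "f 2 = v"
    using full_edge_closed_walk[OF assms] by blast
  let ?C = "f ` {..<g}"
  have cover: "pverts G \<subseteq> ?C \<union> nbrs G u \<union> nbrs G v"
    using edge_degree_sum_le(2)[OF f uv full] by blast
  define idx where "idx = the_inv_into {..<g} f"
  have idx: "idx (f i) = i" if "i < g" for i
    unfolding idx_def using that by (intro the_inv_into_f_f[OF inj_f[OF f]]) auto
  \<comment> \<open>A neighbour of \<open>u = f 1\<close> has to go to class 0 or 2, a neighbour of
    \<open>v = f 2\<close> to class 1 or 3. An edge to \<open>f (g - 1)\<close> forces 0 and an edge
    to \<open>f 4\<close> forces 3; otherwise the inner class is taken.\<close>
  define \<phi> where "\<phi> x = (if x \<in> ?C then idx x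
     else if x \<in> nbrs G u then (if f (g - 1) \<in> nbrs G x then 0 else 2)
     else (if f 4 \<in> nbrs G x then 3 else 1))" for x
  have \<phi>f: "\<phi> (f i) = i" if "i < g" for i using that by (auto simp: \<phi>_def idx)
  \<comment> \<open>Apart from \<open>f 1\<close>, only cycle vertices two steps away from position
    1 can be adjacent to \<open>x\<close>. Both at once are impossible, since their positions differ
    by \<open>g - 4\<close>, which is neither 2 nor \<open>g - 2\<close>. The facts
    \<open>nbv\<close> are the analogue around position 2.\<close>
  have nbu: "i = 1 \<or> i = 3 \<or> i = g - 1" "\<not> (f 3 \<in> nbrs G x \<and> f (g - 1) \<in> nbrs G x)"
    if x: "x \<in> nbrs G u" and i: "i < g" "f i \<in> nbrs G x" for x i
  proof -
    have 1: "f 1 \<in> nbrs G x" using x f12 nbrs_sym[of x u] by simp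
    show "i = 1 \<or> i = 3 \<or> i = g - 1"
    proof (cases i "1 :: nat" rule: linorder_cases)
      case less
      then show ?thesis using common_nbr_dist[OF f, of i 1 x] i 1 g_ge_7 by auto
    next
      case greater
      then show ?thesis using common_nbr_dist[OF f greater i(1) 1 i(2)] by auto
    qed simp
    have "g - 4 \<noteq> 2" using odd_g g_ge_7 by presburger
    then have "\<not> (g - 1 - 3 = 2 \<or> g - 1 - 3 = g - 2)" "3 < g - 1" "g - 1 < g"
      using g_ge_7 by linarith+
    then show "\<not> (f 3 \<in> nbrs G x \<and> f (g - 1) \<in> nbrs G x)"
      using common_nbr_dist[OF f, of 3 "g - 1" x] by blast
  qed
  have nbv: "i = 0 \<or> i = 2 \<or> i = 4" "\<not> (f 0 \<in> nbrs G x \<and> f 4 \<in> nbrs G x)"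
    if x: "x \<in> nbrs G v" and i: "i < g" "f i \<in> nbrs G x" for x i
  proof -
    have 2: "f 2 \<in> nbrs G x" using x f12 nbrs_sym[of x v] by simp
    show "i = 0 \<or> i = 2 \<or> i = 4"
    proof (cases i "2 :: nat" rule: linorder_cases)
      case less
      then show ?thesis using common_nbr_dist[OF f, of i 2 x] i 2 g_ge_7 by auto
    next
      case greater
      then show ?thesis using common_nbr_dist[OF f greater i(1) 2 i(2)] i(1) by auto
    qed simp
    have "\<not> ((4::nat) - 0 = 2 \<or> 4 - 0 = g - 2)" "0 < (4::nat)" "4 < g"
      using odd_g g_ge_7 by presburger+
    then show "\<not> (f 0 \<in> nbrs G x \<and> f 4 \<in> nbrs G x)"
      using common_nbr_dist[OF f, of 0 4 x] by blast
  qed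
  have C_out: "cyc_adj g i (\<phi> x)" if i: "i < g" "f i \<in> nbrs G x" and x: "x \<in> pverts G" "x \<notin> ?C" for i x
  proof (cases "x \<in> nbrs G u")
    case True
    show ?thesis
      using nbu[OF True i] x True i g_ge_7 cyc_adj_Suc[of 0 g] cyc_adj_Suc[of 1 g] cyc_adj_Suc[of 2 g]
        cyc_adj_last[of g] cyc_adj_commute[of g]
      by (auto simp: \<phi>_def numeral_eq_Suc)
  next
    case False
    then have "x \<in> nbrs G v" using cover x by blast
    show ?thesis
      using nbv[OF \<open>x \<in> nbrs G v\<close> i] x False i g_ge_7 cyc_adj_Suc[of 0 g] cyc_adj_Suc[of 1 g] cyc_adj_Suc[of 2 g]
        cyc_adj_Suc[of 3 g] cyc_adj_commute[of g]
      by (auto simp: \<phi>_def numeral_eq_Suc)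
  qed
  have out_out: "cyc_adj g (\<phi> x) (\<phi> y)"
    if xy: "y \<in> nbrs G x" "x \<notin> ?C" "y \<notin> ?C" "x \<in> nbrs G u" "y \<notin> nbrs G u" for x y
  proof -
    \<comment> \<open>Of the possible pairs of classes only 0 with 3 is bad. It would give a walk of
      length 3 from \<open>f 4\<close> to \<open>f (g - 1)\<close>, closing the even arc of length
      \<open>g - 5\<close> to an odd closed walk of length \<open>g - 2\<close>.\<close>
    have "\<not> (f (g - 1) \<in> nbrs G x \<and> f 4 \<in> nbrs G y)"
    proof
      assume *: "f (g - 1) \<in> nbrs G x \<and> f 4 \<in> nbrs G y"
      have "(f 4, y) \<in> parcs G" "(y, x) \<in> parcs G" "(x, f (g - 1)) \<in> parcs G"
        using * xy(1) nbrs_sym[of y x] nbrs_sym[of "f 4" y] by (auto simp: nbrs_def)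
      then have "(f 4, f (g - 1)) \<in> parcs G ^^ 3" by (auto simp: numeral_3_eq_3)
      moreover have "even (g - 1 - 4)" using odd_g g_ge_7 by auto
      moreover have "4 < g - 1" "g - 1 < g" using g_ge_7 by linarith+
      ultimately have "g \<le> g - 1 - 4 + 3" using relpow_between(2)[OF f, of 4 "g - 1" 3] by simp
      then show False using g_ge_7 by linarith
    qed
    then show ?thesis
      using xy g_ge_7 cyc_adj_Suc[of 0 g] cyc_adj_Suc[of 1 g] cyc_adj_Suc[of 2 g] cyc_adj_commute[of g]
      by (auto simp: \<phi>_def numeral_eq_Suc)
  qed
  have adj: "cyc_adj g (\<phi> x) (\<phi> y)" if xy: "(x, y) \<in> parcs G" for x y
  proof -
    have V: "x \<in> pverts G" "y \<in> pverts G" using wellformed' xy by auto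
    have nb: "y \<in> nbrs G x" "x \<in> nbrs G y" using xy arcs_symmetric by (auto simp: nbrs_def)
    consider "x \<in> ?C" "y \<in> ?C" | "x \<in> ?C" "y \<notin> ?C" | "x \<notin> ?C" "y \<in> ?C" | "x \<notin> ?C" "y \<notin> ?C" by blast
    then show ?thesis
    proof cases
      case 1
      then obtain i j where ij: "i < g" "j < g" "x = f i" "y = f j" by auto
      have "i \<noteq> j" using ij nb nbrs_irrefl by auto
      have *: "cyc_adj g i j" if "i < j" "j < g" "f j \<in> nbrs G (f i)" for i j
      proof -
        from chord_free[OF f that] have "j = Suc i \<or> (i = 0 \<and> j = g - 1)" using that by linarith
        then show ?thesis using cyc_adj_Suc[of i g] cyc_adj_last[of g] that by auto
      qed
      from \<open>i \<noteq> j\<close> have "i < j \<or> j < i" by linarith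
      then have "cyc_adj g i j" using *[of i j] *[of j i] ij nb cyc_adj_commute by blast
      then show ?thesis using ij \<phi>f by simp
    next
      case 2
      then show ?thesis using C_out[of _ y] V nb \<phi>f by auto
    next
      case 3
      then show ?thesis using C_out[of _ x] V nb \<phi>f cyc_adj_commute by auto
    next
      case 4
      \<comment> \<open>Every vertex off the cycle is a neighbour of \<open>u\<close> or
        \<open>v\<close>, and an edge inside either neighbourhood would create a triangle.\<close>
      have "x \<in> nbrs G u \<longleftrightarrow> y \<notin> nbrs G u"
        using no_triangle[of x u y] no_triangle[of x v y] cover V nb 4 by blast
      then show ?thesis using out_out[of y x] out_out[of x y] nb 4 cyc_adj_commute by blast
    qed
  qed
  define n where "n i = card {x \<in> pverts G. \<phi> x = i}" for i
  have range: "\<phi> x < g" if "x \<in> pverts G" for x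
    using g_ge_7 idx by (auto simp: \<phi>_def)
  have n1: "n i = 1" if "4 \<le> i" "i < g" for i
  proof -
    have "x = f i" if "x \<in> pverts G" "\<phi> x = i" for x
      using that \<open>4 \<le> i\<close> \<phi>f by (cases "x \<in> ?C") (auto simp: \<phi>_def split: if_splits)
    moreover have "f i \<in> pverts G" "\<phi> (f i) = i" using f_verts[OF f] \<phi>f that by auto
    ultimately have "{x \<in> pverts G. \<phi> x = i} = {f i}" by blast
    then show ?thesis by (simp add: n_def)
  qed
  have npos: "0 < n i" if "i < g" for i
  proof -
    have "f i \<in> {x \<in> pverts G. \<phi> x = i}" using \<phi>f[OF that] f_verts[OF f] that by auto
    then show ?thesis using pair_finite_verts unfolding n_def card_gt_0_iff by auto
  qed
  have hom: "cyc_hom G g \<phi> (four_sizes (n 0) (n 1) (n 2) (n 3))"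
    unfolding cyc_hom_def
  proof (intro conjI ballI allI impI)
    fix i assume "i < g"
    then show "card {u \<in> pverts G. \<phi> u = i} = four_sizes (n 0) (n 1) (n 2) (n 3) i"
      using n1[of i] unfolding n_def[symmetric] by (auto simp: four_sizes_def)
  qed (use range adj in auto)
  have "card (pverts G) = (\<Sum>i<g. n i)"
  proof -
    have "card (pverts G) = (\<Sum>i\<in>{..<g}. card {x \<in> pverts G. \<phi> x = i})"
      unfolding card_eq_sum using pair_finite_verts range
      by (subst sum.group[of _ "{..<g}" \<phi>, symmetric]) auto
    then show ?thesis by (simp add: n_def)
  qed
  also have "\<dots> = (\<Sum>i<4. n i) + (\<Sum>i\<in>{4..<g}. n i)"
    using g_ge_7 by (subst sum.union_disjoint[symmetric]) (auto intro: sum.cong)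
  also have "(\<Sum>i\<in>{4..<g}. n i) = g - 4" using n1 by simp
  also have "(\<Sum>i<4. n i) = n 0 + n 1 + n 2 + n 3" by (simp add: numeral_eq_Suc)
  finally have "n 0 + n 1 + n 2 + n 3 + g = card (pverts G) + 4" using g_ge_7 by simp
  moreover have "0 < n 0" "0 < n 1" "0 < n 2" "0 < n 3" using npos g_ge_7 by auto
  ultimately show ?thesis using hom by blast
qed

end

section \<open>Supersolutions for four blown-up classes\<close>

text \<open>\<open>x0\<close> to \<open>x4\<close> and \<open>y\<close> are the weights on classes 0
  to 4 and \<open>L - 1\<close>; the rest of the cycle has constant weight \<open>x5\<close>. The
  maxima in \<open>e5\<close> let one inequality serve all of these vertices, including vertex 5 for
  \<open>L = 7\<close>, which is next to both 4 and \<open>L - 1\<close>.\<close>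

lemma four_sizes_supersolution:
  fixes x0 x1 x2 x3 x4 x5 y q :: real
  assumes L: "L \<ge> 7"
    and pos: "x0 > 0" "x1 > 0" "x2 > 0" "x3 > 0" "x4 > 0" "x5 > 0" "y > 0"
    and e0: "b * (x0 + x1) + (x0 + y) \<le> q * x0"
    and e1: "a * (x1 + x0) + c * (x1 + x2) \<le> q * x1"
    and e2: "b * (x2 + x1) + d * (x2 + x3) \<le> q * x2"
    and e3: "c * (x3 + x2) + (x3 + x4) \<le> q * x3"
    and e4: "d * (x4 + x3) + (x4 + x5) \<le> q * x4"
    and e6: "a * (y + x0) + (y + x5) \<le> q * y"
    and e5: "2 * x5 + max x4 x5 + max y x5 \<le> q * x5"
  shows "\<exists>W. cyc_supersolution L (four_sizes a b c d) q W"
proof -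
  define W where "W i = (if i = 0 then x0 else if i = 1 then x1 else if i = 2 then x2
    else if i = 3 then x3 else if i = 4 then x4 else if i = L - 1 then y else x5)" for i
  have "cyc_supersolution L (four_sizes a b c d) q W"
  proof (rule cyc_supersolutionI)
    show "L \<ge> 3" using L by simp
    show "W i > 0" for i using pos by (simp add: W_def)
    show "real (four_sizes a b c d 1) * (W 0 + W 1) +
        real (four_sizes a b c d (L - 1)) * (W 0 + W (L - 1)) \<le> q * W 0"
    proof -
      have "W (L - 1) = y" "four_sizes a b c d (L - 1) = 1" "W 0 = x0" "W 1 = x1"
        using L by (auto simp: W_def four_sizes_def)
      then show ?thesis using e0 by (simp add: four_sizes_def)
    qed
    show "real (four_sizes a b c d 0) * (W (L - 1) + W 0) +
        real (four_sizes a b c d (L - 2)) * (W (L - 1) + W (L - 2)) \<le> q * W (L - 1)"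
    proof -
      have "W (L - 2) = x5" "four_sizes a b c d (L - 2) = 1" "W (L - 1) = y" "W 0 = x0"
        using L by (auto simp: W_def four_sizes_def)
      then show ?thesis using e6 by (simp add: four_sizes_def)
    qed
    fix i assume i: "0 < i" "i < L - 1"
    consider "i = 1" | "i = 2" | "i = 3" | "i = 4" | "i \<ge> 5" using i by linarith
    then show "real (four_sizes a b c d (Suc i)) * (W i + W (Suc i)) +
         real (four_sizes a b c d (i - 1)) * (W i + W (i - 1)) \<le> q * W i"
    proof cases
      case 5
      then have "W i = x5" "W (i - 1) \<le> max x4 x5" "W (Suc i) \<le> max y x5"
        "four_sizes a b c d (Suc i) = 1" "four_sizes a b c d (i - 1) = 1"
        using i by (auto simp: W_def four_sizes_def)
      then show ?thesis using e5 by simp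
    qed (use L e1 e2 e3 e4 in \<open>auto simp: W_def four_sizes_def algebra_simps\<close>)
  qed
  then show ?thesis by blast
qed

text \<open>The origin of the threshold: replacing \<open>N\<close> by \<open>N - 1 / N\<close>
  costs \<open>x / N\<close>, at most 1 for \<open>x <= N\<close>, and a slack of 1 pays for
  it.\<close>

lemma le_minus_inverse_mult:
  fixes N x E :: real
  assumes "N > 0" "x \<le> N" "E + 1 \<le> N * x"
  shows "E \<le> (N - 1 / N) * x"
proof -
  have "x / N \<le> 1" using assms by simp
  then show ?thesis using assms(3) by (simp add: left_diff_distrib)
qed

text \<open>The vertex degrees of the blow-up serve as supersolution.\<close>

lemma supersolution_ends_large:
  fixes N :: real
  assumes L: "L \<ge> 7" and "a \<ge> 2" "b \<ge> 1" "c \<ge> 1" "d \<ge> 2" and N: "N = real (a + b + c + d)"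
  shows "\<exists>W. cyc_supersolution L (four_sizes a b c d) (N - 1 / N) W"
proof -
  \<comment> \<open>Shifting by the lower bounds makes all variables nonnegative. After expansion
    the inequalities are linear in monomials whose signs are listed in \<open>nn\<close> and
    \<open>prods\<close>.\<close>
  define A B C D where "A = real a - 2" and "B = real b - 1" and "C = real c - 1" and "D = real d - 2"
  have eqs: "real a = A + 2" "real b = B + 1" "real c = C + 1" "real d = D + 2"
    by (auto simp: A_def B_def C_def D_def)
  have nn: "0 \<le> A" "0 \<le> B" "0 \<le> C" "0 \<le> D"
    using assms by (auto simp: A_def B_def C_def D_def)
  have NN: "N = A + B + C + D + 6" using N eqs by simp
  have prods: "0 \<le> A * B" "0 \<le> A * C" "0 \<le> A * D" "0 \<le> B * C" "0 \<le> B * D" "0 \<le> C * D"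
    "0 \<le> A * A" "0 \<le> B * B" "0 \<le> C * C" "0 \<le> D * D"
    using nn by simp_all
  have e: "E \<le> (N - 1 / N) * x" if "x \<le> N" "E + 1 \<le> N * x" for E x
    using le_minus_inverse_mult that NN nn by auto
  show ?thesis
    by (rule four_sizes_supersolution[OF L, of "b + 1" "a + c" "b + d" "c + 1" "d + 1" 2 "a + 1"];
        (intro e)?; use nn prods in \<open>simp add: eqs NN algebra_simps\<close>)
qed

text \<open>The vertex degrees, increased on the second class just enough to absorb its deficit.\<close>

lemma supersolution_one_end_large:
  fixes N :: real
  assumes L: "L \<ge> 7" and "a \<ge> 2" "b \<ge> 1" "c \<ge> 2" and N: "N = real (a + b + c + 1)"
  shows "\<exists>W. cyc_supersolution L (four_sizes a b c 1) (N - 1 / N) W"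
proof -
  define A B C where "A = real a - 2" and "B = real b - 1" and "C = real c - 2"
  have eqs: "real a = A + 2" "real b = B + 1" "real c = C + 2"
    by (auto simp: A_def B_def C_def)
  have nn: "0 \<le> A" "0 \<le> B" "0 \<le> C" using assms by (auto simp: A_def B_def C_def)
  have NN: "N = A + B + C + 6" using N eqs by simp
  have prods: "0 \<le> A * B" "0 \<le> A * C" "0 \<le> B * C" "0 \<le> A * A" "0 \<le> B * B" "0 \<le> C * C"
    using nn by simp_all
  have e: "E \<le> (N - 1 / N) * x" if "x \<le> N" "E + 1 \<le> N * x" for E x
    using le_minus_inverse_mult that NN nn by auto
  define s \<epsilon> where "s = A + C + 4" and "\<epsilon> = 1 / N"
  \<comment> \<open>For \<open>d = 1\<close> all edges at class 1 have degree sum \<open>N\<close>.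
    Seen from classes 0 and 2, raising its \<open>b\<close> vertices adds
    \<open>s * \<epsilon>\<close>; together with the loss \<open>\<epsilon> * (b + 1)\<close> on the
    right this uses up exactly the slack 1 available there, so \<open>key\<close> is in fact an
    equality.\<close>
  define x1 where "x1 = s + s * \<epsilon> / b"
  have \<epsilon>: "0 < \<epsilon>" "\<epsilon> \<le> 1" "\<epsilon> * (s + B + 2) = 1"
    using NN nn by (auto simp: \<epsilon>_def s_def field_simps)
  have bx1: "b * x1 = s * b + s * \<epsilon>" using \<open>b \<ge> 1\<close> by (simp add: x1_def field_simps)
  have sN: "N = s + b + 1" using NN eqs by (simp add: s_def)
  have key: "b * (b + 1 + x1) + (b + s) \<le> (N - \<epsilon>) * (b + 1)"
  proof -
    have "s * \<epsilon> = 1 - \<epsilon> * (b + 1)" using \<epsilon>(3) eqs by (simp add: algebra_simps)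
    then have "b * x1 = s * b + 1 - \<epsilon> * (b + 1)" using bx1 by simp
    then show ?thesis by (simp add: sN algebra_simps)
  qed
  have ac: "real a + real c = s" using eqs by (simp add: s_def)
  have key1: "s * x1 + s * (b + 1) \<le> (N - \<epsilon>) * x1"
  proof -
    have "(b + 1 - \<epsilon>) * (b + \<epsilon>) = b * (b + 1) + \<epsilon> * (1 - \<epsilon>)" by (simp add: algebra_simps)
    then have "b * (b + 1) \<le> (b + 1 - \<epsilon>) * (b + \<epsilon>)" using \<epsilon> by simp
    then have "s * (b * (b + 1)) \<le> s * ((b + 1 - \<epsilon>) * (b + \<epsilon>))"
      using nn by (intro mult_left_mono) (auto simp: s_def)
    also have "\<dots> = (b + 1 - \<epsilon>) * (s * b + s * \<epsilon>)" by (simp add: algebra_simps)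
    also have "\<dots> = (b + 1 - \<epsilon>) * (b * x1)" by (simp only: bx1)
    finally have "b * (s * (b + 1)) \<le> b * ((b + 1 - \<epsilon>) * x1)" by (simp add: algebra_simps)
    then have "s * (b + 1) \<le> (b + 1 - \<epsilon>) * x1" using \<open>b \<ge> 1\<close> by simp
    then show ?thesis by (simp add: sN algebra_simps)
  qed
  show ?thesis
  proof (rule four_sizes_supersolution[OF L, of "b + 1" x1 "b + 1" "c + 1" 2 2 "a + 1"])
    show "x1 > 0" unfolding x1_def using \<open>b \<ge> 1\<close> \<epsilon>(1) nn
      by (intro add_pos_nonneg) (auto simp: s_def)
    show "real b * (real (b + 1) + x1) + (real (b + 1) + real (a + 1)) \<le> (N - 1 / N) * real (b + 1)"
      using key ac \<open>c \<ge> 2\<close> by (simp add: \<epsilon>_def algebra_simps)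
    show "real b * (real (b + 1) + x1) + real 1 * (real (b + 1) + real (c + 1)) \<le> (N - 1 / N) * real (b + 1)"
      using key ac \<open>a \<ge> 2\<close> by (simp add: \<epsilon>_def algebra_simps)
    show "real a * (x1 + real (b + 1)) + real c * (x1 + real (b + 1)) \<le> (N - 1 / N) * x1"
      using key1 unfolding ac[symmetric] by (simp add: \<epsilon>_def algebra_simps)
  qed ((intro e)?; use nn prods in \<open>simp add: eqs NN algebra_simps\<close>)+
qed

text \<open>For \<open>a = d = 1\<close> all edges at classes 1 and 2 have degree sum
  \<open>N\<close>, so their degrees \<open>r\<close> and \<open>p\<close> leave no slack. Lowering
  the single vertex of class 0 by \<open>\<epsilon> * r\<close> and that of class 3 by
  \<open>\<epsilon> * p\<close> provides exactly what they need.\<close>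

lemma supersolution_middle_large:
  fixes N :: real
  assumes L: "L \<ge> 7" and "b \<ge> 2" "c \<ge> 2" and N: "N = real (b + c + 2)"
  shows "\<exists>W. cyc_supersolution L (four_sizes 1 b c 1) (N - 1 / N) W"
proof -
  define p r \<epsilon> where "p = real b + 1" and "r = real c + 1" and "\<epsilon> = 1 / N"
  have pr: "p \<ge> 3" "r \<ge> 3" "N = p + r" "real b = p - 1" "real c = r - 1"
    using assms by (auto simp: p_def r_def)
  have \<epsilon>: "0 < \<epsilon>" "\<epsilon> * p + \<epsilon> * r = 1" "\<epsilon> \<le> 1"
    unfolding distrib_left[symmetric] using pr by (auto simp: \<epsilon>_def)
  have end_class: "(p - 1) * (p - \<epsilon> * r + r) + (p - \<epsilon> * r + 1) \<le> (N - \<epsilon>) * (p - \<epsilon> * r)"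
    if "p \<ge> 3" "r \<ge> 3" "N = p + r" "\<epsilon> * p + \<epsilon> * r = 1" for p r
  proof -
    have "0 \<le> (p - 3) * (r - 3)" using that by simp
    then have "p + r + p \<le> p * r" using that(1,2) by (simp add: algebra_simps)
    then have "\<epsilon> * (p + r + p) \<le> \<epsilon> * (p * r)" using \<epsilon>(1) by simp
    then have "1 + \<epsilon> * p \<le> \<epsilon> * (p * r)" using that(4) by (simp add: algebra_simps)
    moreover have "(N - \<epsilon>) * (p - \<epsilon> * r) - ((p - 1) * (p - \<epsilon> * r + r) + (p - \<epsilon> * r + 1))
      = r - (\<epsilon> * r) * r - \<epsilon> * p + \<epsilon> * (\<epsilon> * r) - 1"
      unfolding that(3) by (simp add: algebra_simps)
    moreover have "\<epsilon> * r = 1 - \<epsilon> * p" using that(4) by simp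
    then have "(\<epsilon> * r) * r = (1 - \<epsilon> * p) * r" by (simp only:)
    then have "(\<epsilon> * r) * r = r - \<epsilon> * (p * r)" by (simp add: left_diff_distrib)
    moreover have "\<epsilon> * (\<epsilon> * r) \<ge> 0" using \<epsilon>(1) that by simp
    ultimately show ?thesis by linarith
  qed
  have outer: "r - \<epsilon> * p > 0" "1 + (r - \<epsilon> * p) + (1 + 2 / 3) \<le> N - \<epsilon>"
    if "p \<ge> 3" "r \<ge> 3" "N = p + r" "\<epsilon> * p + \<epsilon> * r = 1" for p r
  proof -
    have "\<epsilon> * r > 0" "\<epsilon> * r \<ge> \<epsilon> * 3" using \<epsilon>(1) that by auto
    then show "r - \<epsilon> * p > 0" using that by linarith
    have "\<epsilon> * p \<ge> \<epsilon> * 3" using \<epsilon>(1) that by simp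
    then show "1 + (r - \<epsilon> * p) + (1 + 2 / 3) \<le> N - \<epsilon>" using that \<epsilon>(1) by linarith
  qed
  have \<epsilon>': "\<epsilon> * r + \<epsilon> * p = 1" "N = r + p" using \<epsilon>(2) pr(3) by auto
  note end1 = end_class[OF pr(1,2,3) \<epsilon>(2)] and end2 = end_class[OF pr(2,1) \<epsilon>'(2,1)]
  note out1 = outer[OF pr(1,2,3) \<epsilon>(2)] and out2 = outer[OF pr(2,1) \<epsilon>'(2,1)]
  show ?thesis
    unfolding \<epsilon>_def[symmetric]
  \<comment> \<open>On the vertices 4 and \<open>L - 1\<close> the degree 2 would be too heavy for
    the lowered classes 3 and 0, already when \<open>b = c = 2\<close>; hence the weight 1. With
    \<open>2 / 3\<close> on the rest, the path inequality becomes
    \<open>N - \<epsilon> >= 5\<close>.\<close>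
  proof (rule four_sizes_supersolution[OF L, of "p - \<epsilon> * r" r p "r - \<epsilon> * p" 1 "2 / 3" 1])
    show "p - \<epsilon> * r > 0" "r - \<epsilon> * p > 0" using out1 out2 by auto
    show "r > 0" "p > 0" using pr by auto
    show "real b * (p - \<epsilon> * r + r) + (p - \<epsilon> * r + 1) \<le> (N - \<epsilon>) * (p - \<epsilon> * r)"
      using end1 by (simp add: pr(4))
    show "real c * (r - \<epsilon> * p + p) + (r - \<epsilon> * p + 1) \<le> (N - \<epsilon>) * (r - \<epsilon> * p)"
      using end2 by (simp add: pr(5))
    show "real 1 * (r + (p - \<epsilon> * r)) + real c * (r + p) \<le> (N - \<epsilon>) * r"
      by (simp add: pr(3,5) algebra_simps)
    show "real b * (p + r) + real 1 * (p + (r - \<epsilon> * p)) \<le> (N - \<epsilon>) * p"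
      by (simp add: pr(3,4) algebra_simps)
    show "real 1 * (1 + (r - \<epsilon> * p)) + (1 + 2 / 3) \<le> (N - \<epsilon>) * 1"
      "real 1 * (1 + (p - \<epsilon> * r)) + (1 + 2 / 3) \<le> (N - \<epsilon>) * 1"
      using out1(2) out2(2) by simp_all
    show "2 * (2 / 3) + max 1 (2 / 3) + max 1 (2 / 3) \<le> (N - \<epsilon>) * (2 / 3)"
      using pr \<epsilon>(3) by simp
  qed simp_all
qed

context pair_graph
begin

text \<open>Up to reflection and sliding the window over classes of size 1, the three supersolutions
  cover all patterns with at least two sizes above 1. If at most one is above 1, the same moves
  bring it to class 0.\<close>

lemma four_sizes_q_spectrum_le_or_one_large:
  fixes N :: real
  assumes hom: "cyc_hom G L \<phi> (four_sizes a b c d)" and L: "L \<ge> 7"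
    and pos: "0 < a" "0 < b" "0 < c" "0 < d" and N: "N = real (a + b + c + d)"
  shows "(\<forall>x\<in>q_spectrum G. x \<le> N - 1 / N) \<or>
    (\<exists>\<psi>. cyc_hom G L \<psi> (four_sizes (a + b + c + d - 3) 1 1 1))"
proof -
  let ?Q = "\<forall>x\<in>q_spectrum G. x \<le> N - 1 / N"
  define H where "H a b c d \<longleftrightarrow> (\<exists>\<phi>. cyc_hom G L \<phi> (four_sizes a b c d))" for a b c d
  have bound: ?Q if "H a b c d" "\<exists>W. cyc_supersolution L (four_sizes a b c d) (N - 1 / N) W" for a b c d
    using that cyc_hom_supersolution(1) L unfolding H_def by fastforce
  have cong: "cyc_hom G L \<psi> m'" if "cyc_hom G L \<psi> m" "\<And>i. i < L \<Longrightarrow> m i = m' i" for \<psi> m m'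
    using that by (simp add: cyc_hom_def)
  have mirror: "H d c b a" if h: "H a b c d" for a b c d
  proof -
    obtain \<phi> where \<phi>: "cyc_hom G L \<phi> (four_sizes a b c d)" using h by (auto simp: H_def)
    show ?thesis unfolding H_def
      by (rule exI, rule cong[OF cyc_hom_reflect[OF \<phi>]]) (use L in \<open>auto simp: four_sizes_def\<close>)
  qed
  have right: "H 1 a b 1" if h: "H a b 1 1" for a b
  proof -
    obtain \<phi> where \<phi>: "cyc_hom G L \<phi> (four_sizes a b 1 1)" using h by (auto simp: H_def)
    show ?thesis unfolding H_def
      by (rule exI, rule cong[OF cyc_hom_rotate(1)[OF \<phi>]]) (use L in \<open>auto simp: four_sizes_def cyc_pred_def\<close>)
  qed
  have left: "H b 1 1 1" if h: "H 1 b 1 1" for b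
  proof -
    obtain \<phi> where \<phi>: "cyc_hom G L \<phi> (four_sizes 1 b 1 1)" using h by (auto simp: H_def)
    show ?thesis unfolding H_def
      by (rule exI, rule cong[OF cyc_hom_rotate(2)[OF \<phi>]]) (use L in \<open>auto simp: four_sizes_def mod_Suc\<close>)
  qed
  have one_end: "?Q \<or> H (a + b + c - 2) 1 1 1"
    if h: "H a b c 1" and a: "a \<ge> 2" "0 < b" "0 < c" and N: "N = real (a + b + c + 1)" for a b c
  proof -
    consider "c \<ge> 2" | "c = 1" "b \<ge> 2" | "c = 1" "b = 1" using a by linarith
    then show ?thesis
    proof cases
      case 1
      then show ?thesis using bound[OF h supersolution_one_end_large[OF L]] a N by auto
    next
      case 2
      then have "H 1 a b 1" using right h by simp
      then show ?thesis using bound supersolution_middle_large[OF L, of a b N] 2 a N by auto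
    next
      case 3
      then show ?thesis using h by simp
    qed
  qed
  have h: "H a b c d" using hom by (auto simp: H_def)
  consider "a \<ge> 2" "d \<ge> 2" | "a \<ge> 2" "d = 1" | "a = 1" "d \<ge> 2" | "a = 1" "d = 1" using pos by linarith
  then have "?Q \<or> H (a + b + c + d - 3) 1 1 1"
  proof cases
    case 1
    then show ?thesis using bound[OF h supersolution_ends_large[OF L]] pos N by auto
  next
    case 2
    then show ?thesis using one_end[of a b c] h pos N by simp
  next
    case 3
    have "d + c + b - 2 = a + b + c + d - 3" using 3 by simp
    then show ?thesis using one_end[of d c b] mirror[OF h] pos N 3 by (simp add: ac_simps)
  next
    case 4
    consider "b \<ge> 2" "c \<ge> 2" | "c = 1" | "b = 1" using pos by linarith
    then show ?thesis
    proof cases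
      case 1
      then show ?thesis using bound[of 1 b c 1] h supersolution_middle_large[OF L, of b c N] 4 N by simp
    next
      case 2
      then show ?thesis using left[of b] h 4 by simp
    next
      case 3
      then have "H 1 c 1 1" using mirror[OF h] 4 by simp
      then show ?thesis using left[of c] 3 4 by simp
    qed
  qed
  then show ?thesis by (auto simp: H_def)
qed

end

section \<open>The extremal graph\<close>

lemma ex_plus_inverse_eq:
  fixes z :: real
  assumes "z \<ge> 2"
  shows "\<exists>t. 0 < t \<and> t \<le> 1 \<and> t + 1 / t = z"
proof -
  define s where "s = sqrt (z\<^sup>2 - 4)"
  define t where "t = (z - s) / 2"
  have "z\<^sup>2 \<ge> 2\<^sup>2" using assms by (intro power_mono) auto
  then have s2: "s\<^sup>2 = z\<^sup>2 - 4" and s0: "s \<ge> 0" by (auto simp: s_def)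
  have "s\<^sup>2 < z\<^sup>2" using s2 by simp
  then have "s < z" by (rule power2_less_imp_less) (use assms in simp)
  then have t0: "t > 0" by (simp add: t_def)
  have "t * (z - t) = (z\<^sup>2 - s\<^sup>2) / 4" by (simp add: t_def power2_eq_square field_simps)
  then have prod: "t * (z - t) = 1" using s2 by simp
  have "t * t \<le> t * (z - t)" using t0 s0 by (intro mult_left_mono) (auto simp: t_def field_simps)
  then have "t * t \<le> 1" using prod by simp
  then have "t \<le> 1" using mult_strict_mono[of 1 t 1 t] by (cases "t \<le> 1") auto
  moreover have "t + 1 / t = z" using prod t0 by (simp add: field_simps)
  ultimately show ?thesis using t0 by blast
qed

text \<open>Along the path of vertices of degree two the eigenvector is a combination of \<open>t ^ j\<close> and
  \<open>t ^ (2 * k + 1 - j)\<close> where \<open>t + 1 / t = q - 2\<close>. The condition on \<open>t\<close> is the eigenvalue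
  equation at the two neighbours of the blown-up vertex.\<close>

lemma ex_blow_up_parameter:
  fixes k m :: nat
  assumes "k \<ge> 1" "m \<ge> 1"
  shows "\<exists>t::real. 0 < t \<and> t \<le> 1 \<and>
    (t + 1 / t + 1 - m) * (1 + t ^ (2 * k + 1)) =
      2 * m * (1 + t ^ (2 * k + 1)) / (t + 1 / t) + (t + t ^ (2 * k)) \<and>
    real (m + 3) - 1 / real (m + 3) < 2 + t + 1 / t"
proof -
  define Y where "Y t = 1 + t ^ (2 * k + 1)" for t :: real
  define F where "F t = (t + 1 / t + 1 - m) * Y t - 2 * m * Y t / (t + 1 / t) - (t + t ^ (2 * k))"
    for t :: real
  have y1: "(t + 1 / t) * (t + t ^ (2 * k)) = (1 + t\<^sup>2) * (1 + t ^ (2 * k - 1))" if "t > 0" for t :: real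
  proof -
    have "t ^ (2 * k) = t * t ^ (2 * k - 1)"
      using \<open>k \<ge> 1\<close> by (simp flip: power_Suc)
    then show ?thesis using that by (simp add: field_simps power2_eq_square)
  qed
  have Yk: "Y t = 1 + t\<^sup>2 * t ^ (2 * k - 1)" for t :: real
    using \<open>k \<ge> 1\<close> by (simp add: Y_def flip: power_add)
  \<comment> \<open>The end \<open>t1\<close> corresponds to \<open>q = m + 3\<close>, the degree
    sum bound, and the end \<open>t = 1\<close> to \<open>q = 4\<close>. The solution is found in
    between.\<close>
  obtain t1 :: real where t1: "0 < t1" "t1 \<le> 1" "t1 + 1 / t1 = real m + 1"
    using ex_plus_inverse_eq[of "real m + 1"] \<open>m \<ge> 1\<close> by auto
  have "F t1 \<ge> 0"
  proof -
    have "0 \<le> (1 - t1\<^sup>2) * (1 - t1 ^ (2 * k - 1))"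
      using t1 by (intro mult_nonneg_nonneg) (auto simp: power_le_one)
    also have "\<dots> = 2 * Y t1 - (t1 + 1 / t1) * (t1 + t1 ^ (2 * k))"
      unfolding y1[OF t1(1)] Yk by (simp add: algebra_simps)
    also have "\<dots> = (real m + 1) * F t1"
      unfolding F_def t1(3) by (simp add: field_simps)
    finally show ?thesis by (simp add: zero_le_mult_iff)
  qed
  moreover have "F 1 \<le> 0" using \<open>m \<ge> 1\<close> by (simp add: F_def Y_def)
  moreover have "continuous_on {t1..1} F"
  proof -
    have "t \<noteq> 0 \<and> t + 1 / t \<noteq> 0" if "t \<in> {t1..1}" for t
      using that t1(1) add_pos_pos[of t "1 / t"] by auto
    then show ?thesis unfolding F_def Y_def by (intro continuous_intros) auto
  qed
  ultimately obtain t where t: "t1 \<le> t" "t \<le> 1" "F t = 0"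
    using IVT2'[of F 1 0 t1] t1(2) by auto
  have t0: "t > 0" using t t1 by simp
  define z where "z = t + 1 / t"
  have z2: "z \<ge> 2"
  proof -
    have "z * t = t * t + 1" using t0 by (simp add: z_def distrib_right)
    moreover have "0 \<le> (1 - t) * (1 - t)" by simp
    ultimately have "2 * t \<le> z * t" by (simp add: algebra_simps)
    then show ?thesis using t0 by simp
  qed
  have Ypos: "Y t > 0" unfolding Y_def using t0 by (simp add: add_pos_pos)
  have eq: "z * (z + 1 - m) * Y t = 2 * m * Y t + z * (t + t ^ (2 * k))"
    using t(3) z2 unfolding F_def z_def[symmetric] by (simp add: field_simps)
  \<comment> \<open>This estimate eliminates \<open>k\<close>: after division by \<open>Y t\<close>
    an inequality in \<open>z\<close>, \<open>m\<close> and \<open>t\<close> remains.\<close>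
  have "(1 + t\<^sup>2) * Y t \<le> z * (t + t ^ (2 * k))"
  proof -
    have "t ^ (2 * k + 1) \<le> t ^ (2 * k - 1)" using t0 t(2) by (intro power_decreasing) auto
    then show ?thesis unfolding z_def y1[OF t0] Y_def by (intro mult_left_mono) auto
  qed
  then have "(2 * m + 1 + t\<^sup>2) * Y t \<le> z * (z + 1 - m) * Y t" unfolding eq by (simp add: algebra_simps)
  then have ge: "2 * m + 1 + t\<^sup>2 \<le> z * (z + 1 - m)" using Ypos by simp
  define N where "N = real (m + 3)"
  have N: "N > 0" "real m = N - 3" by (auto simp: N_def)
  have "N - 1 / N < 2 + z"
  proof (rule ccontr)
    assume "\<not> N - 1 / N < 2 + z"
    then have le: "2 + z \<le> N - 1 / N" by simp
    have invN: "0 < 1 / N" "1 / N \<le> 1" by (auto simp: N_def)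
    then have "1 / t < N" using le t0 unfolding z_def by linarith
    then have "1 / N < t" using t0 N by (simp add: field_simps)
    then have "(1 / N)\<^sup>2 < t\<^sup>2" using N by (intro power_strict_mono) auto
    moreover define \<delta> where "\<delta> = N - 2 - z"
    \<comment> \<open>\<open>\<delta>\<close> lies between \<open>1 / N\<close> and
      \<open>N - 1 / N\<close>. Hence \<open>\<delta>^2 - N * \<delta> + 1\<close> is at most
      \<open>(1 / N)^2\<close>, while \<open>ge\<close> says that it is at least
      \<open>t^2\<close>.\<close>
    have "(\<delta> - 1 / N) * (\<delta> + 1 / N - N) \<le> 0"
      using le z2 invN by (intro mult_nonneg_nonpos; unfold \<delta>_def; linarith)
    moreover have "(\<delta> - 1 / N) * (\<delta> + 1 / N - N) = \<delta>\<^sup>2 - N * \<delta> + 1 - (1 / N)\<^sup>2"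
      using N by (simp add: field_simps power2_eq_square)
    moreover have z: "z = N - 2 - \<delta>" by (simp add: \<delta>_def)
    have "z * (z + 1 - m) = (N - 2 - \<delta>) * (N - 2 - \<delta> + 1 - (N - 3))" by (simp only: z N(2))
    then have "z * (z + 1 - m) = 2 * N - 4 - N * \<delta> + \<delta>\<^sup>2"
      by (simp add: algebra_simps power2_eq_square)
    ultimately show False using ge N(2) by linarith
  qed
  then have "real (m + 3) - 1 / real (m + 3) < 2 + t + 1 / t" by (simp add: N_def z_def)
  moreover have "(t + 1 / t + 1 - m) * (1 + t ^ (2 * k + 1)) =
      2 * m * (1 + t ^ (2 * k + 1)) / (t + 1 / t) + (t + t ^ (2 * k))"
    using t(3) by (simp add: F_def Y_def)
  ultimately show ?thesis using t0 t(2) by blast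
qed

text \<open>The exponents \<open>j\<close> and \<open>2 * k + 1 - j\<close> are exchanged by the
  reflection of the cycle that fixes the blown-up class. So the equations at its two neighbours
  coincide, as \<open>hub\<close>, and both powers satisfy the recurrence along the path.\<close>

lemma ex_blow_up_eigenpair:
  fixes k m :: nat
  assumes "k \<ge> 1" "m \<ge> 1" and L: "L = 2 * k + 3" and n: "n = four_sizes m 1 1 1"
  shows "\<exists>q W. real (m + 3) - 1 / real (m + 3) < q \<and> (\<forall>i<L. W i > 0 \<and>
     real (n (Suc i mod L)) * (W i + W (Suc i mod L)) + real (n (cyc_pred L i)) * (W i + W (cyc_pred L i))
       = q * W i)"
proof -
  obtain t :: real where t: "0 < t" "t \<le> 1"
    and eq: "(t + 1 / t + 1 - m) * (1 + t ^ (2 * k + 1)) =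
      2 * m * (1 + t ^ (2 * k + 1)) / (t + 1 / t) + (t + t ^ (2 * k))"
    and gt: "real (m + 3) - 1 / real (m + 3) < 2 + t + 1 / t"
    using ex_blow_up_parameter[OF assms(1,2)] by blast
  define q where "q = 2 + t + 1 / t"
  define y where "y j = t ^ j + t ^ (2 * k + 1 - j)" for j
  \<comment> \<open>The value at 0 solves \<open>2 * (W 0 + W 1) = q * W 0\<close>, the equation at
    the blown-up vertices.\<close>
  define W where "W i = (if i = 0 then 2 * (1 + t ^ (2 * k + 1)) / (t + 1 / t) else y (i - 1))" for i
  have z: "t + 1 / t > 0" using t by (simp add: add_pos_pos)
  have Y: "1 + t ^ (2 * k + 1) > 0" using t by (simp add: add_pos_pos)
  have Wpos: "W i > 0" for i
    using t z Y by (simp add: W_def y_def add_pos_pos)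
  have W0: "2 * (W 0 + (1 + t ^ (2 * k + 1))) = q * W 0"
    using z by (simp add: W_def q_def field_simps)
  have n: "n 0 = m" "\<And>i. i > 0 \<Longrightarrow> n i = 1" by (auto simp: n four_sizes_def)
  have ends: "W 1 = 1 + t ^ (2 * k + 1)" "W 2 = t + t ^ (2 * k)"
    "W (L - 1) = 1 + t ^ (2 * k + 1)" "W (L - 2) = t + t ^ (2 * k)"
    using \<open>k \<ge> 1\<close> by (auto simp: W_def y_def L)
  have hub: "m * (1 + t ^ (2 * k + 1) + W 0) + (1 + t ^ (2 * k + 1) + (t + t ^ (2 * k)))
      = q * (1 + t ^ (2 * k + 1))"
  proof -
    have "m * W 0 = 2 * m * (1 + t ^ (2 * k + 1)) / (t + 1 / t)" by (simp add: W_def)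
    then have "m * W 0 + (t + t ^ (2 * k)) = (t + 1 / t + 1 - m) * (1 + t ^ (2 * k + 1))"
      using eq by simp
    then show ?thesis by (simp add: q_def algebra_simps)
  qed
  have path: "(W i + W (Suc i)) + (W i + W (i - 1)) = q * W i" if i: "2 \<le> i" "i < L - 1" for i
  proof -
    have shift: "t ^ a + t ^ Suc (Suc a) = (t + 1 / t) * t ^ Suc a" for a
      using t by (simp add: field_simps)
    obtain a where a: "i = Suc (Suc a)" using i by (metis add_2_eq_Suc le_Suc_ex)
    define b where "b = 2 * k - 1 - a"
    have b: "2 * k + 1 = a + Suc (Suc b)" using i a L by (simp add: b_def)
    have "W i = t ^ Suc a + t ^ Suc b" "W (Suc i) = t ^ Suc (Suc a) + t ^ b"
      "W (i - 1) = t ^ a + t ^ Suc (Suc b)"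
      unfolding W_def y_def a b by auto
    then have "W (i - 1) + W (Suc i) = (t + 1 / t) * W i"
      using shift[of a] shift[of b] by (simp add: distrib_left)
    then show ?thesis by (simp add: q_def algebra_simps)
  qed
  have "real (n (Suc i mod L)) * (W i + W (Suc i mod L))
      + real (n (cyc_pred L i)) * (W i + W (cyc_pred L i)) = q * W i" if i: "i < L" for i
  proof -
    have "L \<ge> 3" by (simp add: L)
    from cyc_position_cases[OF this i] consider
      "i = 0" "Suc i mod L = 1" "cyc_pred L i = L - 1"
      | "i = L - 1" "Suc i mod L = 0" "cyc_pred L i = L - 2"
      | "i = 1" "Suc i mod L = 2" "cyc_pred L i = 0"
      | "2 \<le> i" "i < L - 1" "Suc i mod L = Suc i" "cyc_pred L i = i - 1"
      by (cases "i = 1") auto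
    then show ?thesis
    proof cases
      case 1
      then show ?thesis using W0 ends n(2) by (simp add: L)
    next
      case 2
      then show ?thesis using hub ends n by (simp add: L)
    next
      case 3
      then show ?thesis using hub ends n by simp
    next
      case 4
      then show ?thesis using path[of i] n(2) by simp
    qed
  qed
  then show ?thesis using gt Wpos by (intro exI[of _ q] exI[of _ W]) (auto simp: q_def)
qed

lemma blow_up_cycle_graph_cyc_hom:
  assumes "L \<ge> 3" and B: "B = blow_up (cycle_graph L) (\<lambda>i. if i = 1 then m else 1)"
  shows "cyc_hom B L (\<lambda>u. fst u - 1) (four_sizes m 1 1 1)"
    and "u \<in> pverts B \<Longrightarrow> v \<in> pverts B \<Longrightarrow>
      cyc_adj L (fst u - 1) (fst v - 1) \<Longrightarrow> (u, v) \<in> parcs B"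
proof -
  have V: "pverts B = (SIGMA i:{1..L}. {..<if i = 1 then m else 1})"
    by (simp add: B blow_up_def cycle_graph_def)
  have A: "(u, v) \<in> parcs B \<longleftrightarrow> cyc_adj L (fst u - 1) (fst v - 1)"
    if mem: "u \<in> pverts B" "v \<in> pverts B" for u v
  proof -
    obtain i a where u: "u = (Suc i, a)"
      using mem(1) by (cases u; cases "fst u") (auto simp: V)
    obtain j b where v: "v = (Suc j, b)"
      using mem(2) by (cases v; cases "fst v") (auto simp: V)
    show ?thesis
      using mem unfolding u v by (auto simp: B blow_up_def cycle_graph_def cyc_adj_def split: if_splits)
  qed
  then show "u \<in> pverts B \<Longrightarrow> v \<in> pverts B \<Longrightarrow>
      cyc_adj L (fst u - 1) (fst v - 1) \<Longrightarrow> (u, v) \<in> parcs B"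
    by blast
  interpret B: pair_graph B
    unfolding B by (intro pair_graph_blow_up pair_graph_cycle_graph assms(1))
  have "card {u \<in> pverts B. fst u - 1 = i} = four_sizes m 1 1 1 i" if "i < L" for i
  proof -
    have "{u \<in> pverts B. fst u - 1 = i} = {Suc i} \<times> {..<if Suc i = 1 then m else 1}"
      using that by (auto simp: V)
    then show ?thesis by (simp add: four_sizes_def)
  qed
  then show "cyc_hom B L (\<lambda>u. fst u - 1) (four_sizes m 1 1 1)"
    unfolding cyc_hom_def
  proof (intro conjI allI impI)
    show "\<forall>u\<in>pverts B. fst u - 1 < L" by (auto simp: V)
    show "\<forall>(u, v)\<in>parcs B. cyc_adj L (fst u - 1) (fst v - 1)"
    proof (intro ballI case_prodI2)
      fix e u v assume "e \<in> parcs B" "e = (u, v)"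
      then show "cyc_adj L (fst u - 1) (fst v - 1)" using A[of u v] B.wellformed'[of u v] by blast
    qed
  qed
qed

text \<open>When all allowed edges are present, adjacency depends on the classes alone, so arbitrary
  bijections between corresponding classes glue to an isomorphism.\<close>

lemma cyc_hom_full_iso:
  assumes G: "pair_graph G" and H: "pair_graph H"
    and \<phi>: "cyc_hom G L \<phi> m" and \<psi>: "cyc_hom H L \<psi> m"
    and full\<phi>: "\<And>u v. u \<in> pverts G \<Longrightarrow> v \<in> pverts G \<Longrightarrow> cyc_adj L (\<phi> u) (\<phi> v) \<Longrightarrow> (u, v) \<in> parcs G"
    and full\<psi>: "\<And>u v. u \<in> pverts H \<Longrightarrow> v \<in> pverts H \<Longrightarrow> cyc_adj L (\<psi> u) (\<psi> v) \<Longrightarrow> (u, v) \<in> parcs H"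
  shows "digraph_iso (with_proj G) (with_proj H)"
proof -
  interpret G: pair_graph G by fact
  interpret H: pair_graph H by fact
  have "\<exists>h. bij_betw h {u \<in> pverts G. \<phi> u = i} {u \<in> pverts H. \<psi> u = i}" if "i < L" for i
    using that \<phi> \<psi> G.pair_finite_verts H.pair_finite_verts
    by (intro finite_same_card_bij) (auto simp: cyc_hom_def)
  then obtain h where h: "\<And>i. i < L \<Longrightarrow> bij_betw (h i) {u \<in> pverts G. \<phi> u = i} {u \<in> pverts H. \<psi> u = i}"
    by metis
  define f where "f u = h (\<phi> u) u" for u
  have \<phi>L: "\<phi> u < L" if "u \<in> pverts G" for u using \<phi> that by (simp add: cyc_hom_def)
  have \<psi>L: "\<psi> u < L" if "u \<in> pverts H" for u using \<psi> that by (simp add: cyc_hom_def)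
  have f: "f u \<in> pverts H \<and> \<psi> (f u) = \<phi> u" if "u \<in> pverts G" for u
    using bij_betwE[OF h[OF \<phi>L[OF that]]] that by (auto simp: f_def)
  have "bij_betw f (pverts G) (pverts H)"
    unfolding bij_betw_def
  proof
    show "inj_on f (pverts G)"
    proof (rule inj_onI)
      fix u v assume uv: "u \<in> pverts G" "v \<in> pverts G" "f u = f v"
      then have "\<phi> u = \<phi> v" using f by metis
      then show "u = v"
        using bij_betw_imp_inj_on[OF h[OF \<phi>L[OF uv(1)]]] uv by (auto simp: f_def dest: inj_onD)
    qed
    show "f ` pverts G = pverts H"
    proof (intro equalityI subsetI)
      fix x assume x: "x \<in> pverts H"
      then have "x \<in> h (\<psi> x) ` {u \<in> pverts G. \<phi> u = \<psi> x}"
        using bij_betw_imp_surj_on[OF h[OF \<psi>L[OF x]]] by auto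
      then obtain u where "u \<in> pverts G" "\<phi> u = \<psi> x" "x = h (\<psi> x) u" by blast
      then show "x \<in> f ` pverts G" by (intro image_eqI[of _ _ u]) (simp_all add: f_def)
    qed (use f in auto)
  qed
  moreover have "(f u, f v) \<in> parcs H \<longleftrightarrow> (u, v) \<in> parcs G" if "u \<in> pverts G" "v \<in> pverts G" for u v
  proof -
    have "(u, v) \<in> parcs G \<longleftrightarrow> cyc_adj L (\<phi> u) (\<phi> v)"
      using full\<phi> that \<phi> by (auto simp: cyc_hom_def)
    moreover have "(f u, f v) \<in> parcs H \<longleftrightarrow> cyc_adj L (\<psi> (f u)) (\<psi> (f v))"
      using full\<psi> f that \<psi> by (auto simp: cyc_hom_def)
    ultimately show ?thesis using f that by simp
  qed
  ultimately show ?thesis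
    using H.wellformed' by (intro digraph_iso_with_projI[OF G.pair_wf_digraph]) auto
qed

context pair_graph
begin

lemma cyc_hom_full_eigenvalue:
  assumes hom: "cyc_hom G L \<phi> m" and L: "L \<ge> 3" and "pverts G \<noteq> {}"
    and full: "\<And>u v. u \<in> pverts G \<Longrightarrow> v \<in> pverts G \<Longrightarrow> cyc_adj L (\<phi> u) (\<phi> v) \<Longrightarrow> (u, v) \<in> parcs G"
    and W: "\<And>i. i < L \<Longrightarrow> W i > 0 \<and> real (m (Suc i mod L)) * (W i + W (Suc i mod L))
      + real (m (cyc_pred L i)) * (W i + W (cyc_pred L i)) = q * W i"
  shows "q \<in> q_spectrum G"
proof -
  have \<phi>: "\<phi> u < L" if "u \<in> pverts G" for u using hom that by (simp add: cyc_hom_def)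
  have "(\<Sum>v\<in>nbrs G u. W (\<phi> u) + W (\<phi> v)) = q * W (\<phi> u)" if u: "u \<in> pverts G" for u
  proof -
    have "nbrs G u = {v. v \<in> pverts G \<and> cyc_adj L (\<phi> u) (\<phi> v)}"
      using full[OF u] hom wellformed' by (auto simp: nbrs_def cyc_hom_def)
    then show ?thesis using cyc_hom_sum[OF hom L u, of W] W[OF \<phi>[OF u]] by (simp only:)
  qed
  moreover have "\<exists>v\<in>pverts G. W (\<phi> v) \<noteq> 0" using \<open>pverts G \<noteq> {}\<close> \<phi> W by fastforce
  ultimately show ?thesis
    unfolding q_spectrum_def by (intro CollectI exI[of _ "\<lambda>v. W (\<phi> v)"]) auto
qed

lemma q_spectrum_le_or_one_large:
  fixes N :: real
  assumes "k \<ge> 2" and n: "card (pverts G) = n" "n \<ge> 2 * k + 3" and nb: "\<not> bipartite G"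
    and free: "\<forall>l. odd l \<and> 3 \<le> l \<and> l \<le> 2 * k + 1 \<longrightarrow> \<not> contains_graph G (cycle_graph l)"
    and N: "N = real (n - 2 * k - 2 + 3)"
  shows "(\<forall>x\<in>q_spectrum G. x \<le> N - 1 / N) \<or>
    (\<exists>\<psi>. cyc_hom G (2 * k + 3) \<psi> (four_sizes (n - 2 * k - 2) 1 1 1))"
proof -
  obtain f g where f: "closed_walk G f g" and g: "odd g" "2 * k + 3 \<le> g"
    and least: "\<And>u n. odd n \<Longrightarrow> (u, u) \<in> parcs G ^^ n \<Longrightarrow> g \<le> n"
    using shortest_odd_closed_walk[OF nb free] by blast
  interpret odd_girth_graph G g
    using g \<open>k \<ge> 2\<close> least by unfold_locales auto
  show ?thesis
  proof (cases "\<exists>u v. v \<in> nbrs G u \<and> card (nbrs G u) + card (nbrs G v) + (2 * k + 3) = n + 4")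
    case True
    then obtain u v where uv: "v \<in> nbrs G u"
      and sum: "card (nbrs G u) + card (nbrs G v) + (2 * k + 3) = n + 4" by blast
    \<comment> \<open>A longer shortest odd cycle would keep every degree sum below the value
      attained here.\<close>
    have gL: "g = 2 * k + 3" using edge_degree_sum_le(1)[OF f uv] sum n(1) g(2) by simp
    then obtain \<phi> a b c d where hom: "cyc_hom G (2 * k + 3) \<phi> (four_sizes a b c d)"
      and pos: "0 < a" "0 < b" "0 < c" "0 < d" and abcd: "a + b + c + d + (2 * k + 3) = n + 4"
      using full_edge_cyc_hom[OF f uv] sum n(1) by auto
    have s: "a + b + c + d = n - 2 * k - 2 + 3" using abcd n(2) by simp
    then have "a + b + c + d - 3 = n - 2 * k - 2" by simp
    then show ?thesis
      using four_sizes_q_spectrum_le_or_one_large[OF hom _ pos, of N] N s \<open>k \<ge> 2\<close> by simp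
  next
    case False
    have deg: "real (card (nbrs G u)) + real (card (nbrs G v)) \<le> N - 1" if uv: "v \<in> nbrs G u" for u v
    proof -
      have "card (nbrs G u) + card (nbrs G v) + (2 * k + 3) \<noteq> n + 4" using False uv by blast
      then have "card (nbrs G u) + card (nbrs G v) + (2 * k + 3) \<le> n + 3"
        using edge_degree_sum_le(1)[OF f uv] n(1) g(2) by linarith
      then have "card (nbrs G u) + card (nbrs G v) \<le> n - 2 * k - 2 + 2" using n(2) by linarith
      then show ?thesis unfolding N by linarith
    qed
    have N1: "N \<ge> 1" by (simp add: N)
    then have "1 / N \<le> 1" by simp
    moreover have "x \<le> N - 1" if "x \<in> q_spectrum G" for x
      by (rule q_spectrum_le_degree_sum[OF that]) (use N1 deg in auto)
    ultimately show ?thesis by fastforce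
  qed
qed

end

theorem theorem1p2:
  fixes G :: "'a pair_pre_digraph" and B :: "(nat \<times> nat) pair_pre_digraph" and k n :: nat
  assumes "k \<ge> 2"
    and "pair_graph G"
    and "card (pverts G) = n"
    and "n \<ge> 2 * k + 3"
    and "\<not> bipartite G"
    and "\<forall>l. odd l \<and> 3 \<le> l \<and> l \<le> 2 * k + 1 \<longrightarrow> \<not> contains_graph G (cycle_graph l)"
    and "B = blow_up (cycle_graph (2 * k + 3)) (\<lambda>i. if i = 1 then n - 2 * k - 2 else 1)"
  shows "q_index G \<le> q_index B \<and>
    (q_index G = q_index B \<longleftrightarrow> digraph_iso (with_proj G) (with_proj B))"
proof -
  define L m where "L = 2 * k + 3" and "m = n - 2 * k - 2"
  have L: "L \<ge> 3" and m: "m \<ge> 1" and k: "k \<ge> 1" using assms(1,4) by (auto simp: L_def m_def)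
  have B: "B = blow_up (cycle_graph L) (\<lambda>i. if i = 1 then m else 1)" 
    unfolding assms(7) L_def m_def by (rule refl)
  interpret G: pair_graph G by fact
  have pB: "pair_graph B" unfolding B by (intro pair_graph_blow_up pair_graph_cycle_graph L)
  interpret B: pair_graph B by (rule pB)
  note homB = blow_up_cycle_graph_cyc_hom[OF L B]
  have neG: "pverts G \<noteq> {}" using assms(3,4) by auto
  have "(1, 0) \<in> pverts B" using L m by (simp add: B blow_up_def cycle_graph_def)
  then have neB: "pverts B \<noteq> {}" by blast
  define N where "N = real (m + 3)"
  obtain q W where q: "N - 1 / N < q" and W: "\<And>i. i < L \<Longrightarrow> W i > 0 \<and>
      real (four_sizes m 1 1 1 (Suc i mod L)) * (W i + W (Suc i mod L))
      + real (four_sizes m 1 1 1 (cyc_pred L i)) * (W i + W (cyc_pred L i)) = q * W i"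
    using ex_blow_up_eigenpair[OF k m L_def refl] unfolding N_def by blast
  have super: "cyc_supersolution L (four_sizes m 1 1 1) q W"
    using W by (simp add: cyc_supersolution_def)
  have "q \<in> q_spectrum B"
    by (rule B.cyc_hom_full_eigenvalue[OF homB(1) L neB homB(2) W])
  \<comment> \<open>The positive eigenvector \<open>W\<close> is at the same time a supersolution
    for \<open>B\<close>, so no eigenvalue of \<open>B\<close> exceeds \<open>q\<close>.\<close>
  then have qB: "q_index B = q"
    using B.q_index_eqI B.cyc_hom_supersolution(1)[OF homB(1) L super] by blast
  have iso: "q_index G = q_index B" if "digraph_iso (with_proj G) (with_proj B)"
    using q_spectrum_iso[OF assms(2) that]
    by (simp add: q_index_def G.spectrum_eq_q_spectrum B.spectrum_eq_q_spectrum)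
  from G.q_spectrum_le_or_one_large[OF assms(1,3,4,5,6) N_def[unfolded m_def]]
  show ?thesis
  proof
    assume "\<forall>x\<in>q_spectrum G. x \<le> N - 1 / N"
    then have "q_index G < q_index B" using G.q_index_mem[OF neG] q qB by fastforce
    then show ?thesis using iso by auto
  next
    assume "\<exists>\<psi>. cyc_hom G (2 * k + 3) \<psi> (four_sizes (n - 2 * k - 2) 1 1 1)"
    then obtain \<psi> where \<psi>: "cyc_hom G L \<psi> (four_sizes m 1 1 1)" by (auto simp: L_def m_def)
    note bound = G.cyc_hom_supersolution[OF \<psi> L super G.q_index_mem[OF neG]]
    \<comment> \<open>Equality puts every edge allowed by \<open>\<psi>\<close> into
      \<open>G\<close>, so \<open>G\<close> and \<open>B\<close> are complete blow-ups with the same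
      class sizes.\<close>
    have "digraph_iso (with_proj G) (with_proj B)" if "q_index G = q_index B"
    proof (rule cyc_hom_full_iso[OF assms(2) pB \<psi> homB(1) _ homB(2)])
      have "0 < four_sizes m 1 1 1 i" for i using m by (simp add: four_sizes_def)
      then show "(u, v) \<in> parcs G"
        if "u \<in> pverts G" "v \<in> pverts G" "cyc_adj L (\<psi> u) (\<psi> v)" for u v
        using bound(2) that \<open>q_index G = q_index B\<close> qB by blast
    qed
    then show ?thesis using bound(1) iso qB by auto
  qed
qed

end
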